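(* Let $(\hat G,\hat T)$ be a synthesis of a skeleton comb $(G,T;A,B)$ and a set of tooth grafts $\{(G_v,T_v;r_v):v\in B\}$. Then: (i) a set of edges of $\hat G$ is a minimum join of $(\hat G,\hat T)$ if and only if it is of the form $F\cup\bigcup_{v\in B}F_v$, where $F$ is a minimum join of $(G,T)$ (its edges identified with the corresponding edges of $\hat G$) and, for every $v\in B$, $F_v$ is a minimum join of $(G_v,(T_v\,\Delta\,\{r_v\})\,\Delta\,\{r'_v\})$, where $r'_v\in V(G_v)$ is the end in $V(G_v)$ of the edge of $\hat G$ corresponding to the unique edge of $\delta_G(v)\cap F$; (ii) for every minimum join of $(G,T)$, there is a minimum join of $(\hat G,\hat T)$ containing (the edges of $\hat G$ corresponding to) it.
   Context: All graphs are finite (parallel edges allowed). A graft is a pair $(G,T)$ with $T\subseteq V(G)$; a join is $F\subseteq E(G)$ such that each vertex is incident to an odd number of edges of $F$ iff it lies in $T$; a minimum join is one of minimum size. $\delta_G(Y)$: edges with exactly one end in $Y$; $E_G[Y,Z]$: edges joining $Y$ and $Z$. For $F\subseteq E$ and a subgraph $Q$, $w_F(Q)=|E(Q)\setminus F|-|E(Q)\cap F|$; $\lambda_{(G,T),F}(x,y)$ is the minimum of $w_F(P)$ over paths between $x$ and $y$ ($0$ if $x=y$). A comb $(G,T;A,B)$ is a bipartite graft with color classes $A$ (spine set) and $B$ (tooth set) such that every minimum join $F$ satisfies $|\delta_G(v)\cap F|=1$ for all $v\in B$. A graft $(H,S)$ is primal with respect to $r$ if $\lambda_{(H,S),F'}(r,x)\le0$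 for all $x$ ($F'$ a minimum join); then $A_{(H,S)}(r):=\{x:\lambda_{(H,S),F'}(r,x)=0\}$. Graft contraction: identify a vertex set $Y$ into one vertex (deleting edges inside $Y$), the new vertex being terminal iff $|Y\cap S|$ is odd. Synthesis: given a comb $(G,T;A,B)$ and, for each $v\in B$, a bipartite graft $(G_v,T_v)$ with color classes $A_v,B_v$, primal with respect to $r_v\in A_v$ (all pairwise disjoint and disjoint from $G$), a bipartite graft $(\hat G,\hat T)$ is a synthesis if (1) each $G_v$ is a subgraph of $\hat G$ with the edges of $\hat G$ inside $V(G_v)$ exactly $E(G_v)$ and $\hat T\cap V(G_v)=T_v\Delta\{r_v\}$; (2) contracting each $V(G_v)$ into $v$ yields exactly $(G,T)$ (so edges of $G$ correspond to edges of $\hat G$); (3) $\delta_{\hat G}(V(G_v))=E_{\hat G}[A,A_{(G_v,T_v)}(r_v)]$. *)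

theory Defs
  imports Complex_Main "HOL-Library.Extended_Real" "HOL-Library.Disjoint_Sets"
begin

text \<open>
  Finite undirected graphs in which edges have names, so that parallel edges are distinct edges
  with the same two ends. The value of \<open>ends\<close> outside \<open>edges\<close> carries no meaning, hence equality of
  graphs is \<open>same_graph\<close> below rather than equality of records.
\<close>

record ('v, 'e) mgraph =
  verts :: "'v set"
  edges :: "'e set"
  ends :: "'e \<Rightarrow> 'v set"

definition is_mgraph :: "('v, 'e) mgraph \<Rightarrow> bool" where
  "is_mgraph G \<longleftrightarrow> finite (verts G) \<and> finite (edges G) \<and>
     (\<forall>e\<in>edges G. ends G e \<subseteq> verts G \<and> card (ends G e) = 2)"

definition same_graph :: "('v, 'e) mgraph \<Rightarrow> ('v, 'e) mgraph \<Rightarrow> bool" where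
  "same_graph G H \<longleftrightarrow> verts G = verts H \<and> edges G = edges H \<and> (\<forall>e\<in>edges G. ends G e = ends H e)"

definition subgraph :: "('v, 'e) mgraph \<Rightarrow> ('v, 'e) mgraph \<Rightarrow> bool" where
  "subgraph H G \<longleftrightarrow> verts H \<subseteq> verts G \<and> edges H \<subseteq> edges G \<and> (\<forall>e\<in>edges H. ends H e = ends G e)"

definition bipartition :: "('v, 'e) mgraph \<Rightarrow> 'v set \<Rightarrow> 'v set \<Rightarrow> bool" where
  "bipartition G A B \<longleftrightarrow> A \<union> B = verts G \<and> A \<inter> B = {} \<and>
     (\<forall>e\<in>edges G. ends G e \<inter> A \<noteq> {} \<and> ends G e \<inter> B \<noteq> {})"

definition edge_cut :: "('v, 'e) mgraph \<Rightarrow> 'v set \<Rightarrow> 'e set" where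
  "edge_cut G Y = {e \<in> edges G. card (ends G e \<inter> Y) = 1}"

definition edges_between :: "('v, 'e) mgraph \<Rightarrow> 'v set \<Rightarrow> 'v set \<Rightarrow> 'e set" where
  "edges_between G Y Z = {e \<in> edges G. \<exists>y\<in>Y. \<exists>z\<in>Z. ends G e = {y, z}}"

definition edges_inside :: "('v, 'e) mgraph \<Rightarrow> 'v set \<Rightarrow> 'e set" where
  "edges_inside G Y = {e \<in> edges G. ends G e \<subseteq> Y}"

definition is_path :: "('v, 'e) mgraph \<Rightarrow> 'v \<Rightarrow> 'v list \<Rightarrow> 'e list \<Rightarrow> 'v \<Rightarrow> bool" where
  "is_path G x vs es y \<longleftrightarrow>
     length vs = Suc (length es) \<and> hd vs = x \<and> last vs = y \<and> distinct vs \<and> set vs \<subseteq> verts G \<and>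
     (\<forall>i<length es. es ! i \<in> edges G \<and> ends G (es ! i) = {vs ! i, vs ! Suc i})"

definition is_graft :: "('v, 'e) mgraph \<Rightarrow> 'v set \<Rightarrow> bool" where
  "is_graft G T \<longleftrightarrow> is_mgraph G \<and> T \<subseteq> verts G"

definition is_join :: "('v, 'e) mgraph \<Rightarrow> 'v set \<Rightarrow> 'e set \<Rightarrow> bool" where
  "is_join G T F \<longleftrightarrow> F \<subseteq> edges G \<and>
     (\<forall>v\<in>verts G. odd (card {e \<in> F. v \<in> ends G e}) \<longleftrightarrow> v \<in> T)"

definition minimum_join :: "('v, 'e) mgraph \<Rightarrow> 'v set \<Rightarrow> 'e set \<Rightarrow> bool" where
  "minimum_join G T F \<longleftrightarrow> is_arg_min card (is_join G T) F"

definition join_weight :: "'e set \<Rightarrow> 'e set \<Rightarrow> int" where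
  "join_weight F Q = int (card (Q - F)) - int (card (Q \<inter> F))"

text \<open>
  The infimum is a minimum whenever a path exists, there being finitely many paths; it is \<open>\<infinity>\<close>
  if there is none.
\<close>

definition join_dist :: "('v, 'e) mgraph \<Rightarrow> 'e set \<Rightarrow> 'v \<Rightarrow> 'v \<Rightarrow> ereal" where
  "join_dist G F x y =
     (if x = y then 0
      else (INF (vs, es) \<in> {(vs, es). is_path G x vs es y}. ereal (of_int (join_weight F (set es)))))"

definition comb :: "('v, 'e) mgraph \<Rightarrow> 'v set \<Rightarrow> 'v set \<Rightarrow> 'v set \<Rightarrow> bool" where
  "comb G T A B \<longleftrightarrow> is_graft G T \<and> bipartition G A B \<and>
     (\<forall>F. minimum_join G T F \<longrightarrow> (\<forall>v\<in>B. card (edge_cut G {v} \<inter> F) = 1))"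

text \<open>
  For a minimum join \<open>F\<close> of \<open>(H, S)\<close> the value \<open>join_dist H F x y\<close> does not depend on the choice
  of \<open>F\<close>, so the existential quantifiers in the next two definitions merely pick a minimum join
  to measure distances with.
\<close>

definition primal :: "('v, 'e) mgraph \<Rightarrow> 'v set \<Rightarrow> 'v \<Rightarrow> bool" where
  "primal H S r \<longleftrightarrow> is_graft H S \<and> r \<in> verts H \<and>
     (\<exists>F. minimum_join H S F \<and> (\<forall>x\<in>verts H. join_dist H F r x \<le> 0))"

definition zero_level :: "('v, 'e) mgraph \<Rightarrow> 'v set \<Rightarrow> 'v \<Rightarrow> 'v set" where
  "zero_level H S r = {x \<in> verts H. \<exists>F. minimum_join H S F \<and> join_dist H F r x = 0}"

text \<open>
  Contraction of the (pairwise disjoint) vertex sets \<open>Y v\<close>, \<open>v \<in> B\<close>, the vertex replacing \<open>Y v\<close>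
  being called \<open>v\<close>; surviving edges keep their names. The names in \<open>B\<close> are meant to be fresh,
  i.e. not vertices of the graph that is contracted.
\<close>

definition contract :: "('v, 'e) mgraph \<Rightarrow> 'v set \<Rightarrow> ('v \<Rightarrow> 'v set) \<Rightarrow> ('v, 'e) mgraph" where
  "contract G B Y =
     \<lparr> verts = (verts G - (\<Union>v\<in>B. Y v)) \<union> B,
       edges = edges G - (\<Union>v\<in>B. edges_inside G (Y v)),
       ends = (\<lambda>e. (ends G e - (\<Union>v\<in>B. Y v)) \<union> {v \<in> B. ends G e \<inter> Y v \<noteq> {}}) \<rparr>"

definition contract_terminals :: "'v set \<Rightarrow> 'v set \<Rightarrow> ('v \<Rightarrow> 'v set) \<Rightarrow> 'v set" where
  "contract_terminals T B Y = (T - (\<Union>v\<in>B. Y v)) \<union> {v \<in> B. odd (card (Y v \<inter> T))}"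

text \<open>
  \<open>(Gh, Th)\<close> is a synthesis of the skeleton \<open>(G, T; A, B)\<close> and the tooth grafts
  \<open>(H v, S v; r v)\<close>, \<open>v \<in> B\<close>. Edges of \<open>G\<close> are identified with the corresponding edges of \<open>Gh\<close> by
  having the same name, but may have different ends in the two graphs.
\<close>

definition synthesis ::
  "('v, 'e) mgraph \<Rightarrow> 'v set \<Rightarrow> ('v, 'e) mgraph \<Rightarrow> 'v set \<Rightarrow> 'v set \<Rightarrow> 'v set \<Rightarrow>
   ('v \<Rightarrow> ('v, 'e) mgraph) \<Rightarrow> ('v \<Rightarrow> 'v set) \<Rightarrow> ('v \<Rightarrow> 'v) \<Rightarrow> bool" where
  "synthesis Gh Th G T A B H S r \<longleftrightarrow>
     is_graft Gh Th \<and> (\<exists>C D. bipartition Gh C D) \<and>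
     (\<forall>v\<in>B. subgraph (H v) Gh \<and> edges_inside Gh (verts (H v)) = edges (H v) \<and>
             Th \<inter> verts (H v) = sym_diff (S v) {r v}) \<and>
     B \<inter> verts Gh = {} \<and>
     same_graph (contract Gh B (\<lambda>v. verts (H v))) G \<and>
     contract_terminals Th B (\<lambda>v. verts (H v)) = T \<and>
     (\<forall>v\<in>B. edge_cut Gh (verts (H v)) = edges_between Gh A (zero_level (H v) (S v) (r v)))"

end

theory Submission
  imports Defs
begin

text \<open>
  Everything rests on one estimate for a tooth \<open>(H, S; r)\<close>: if \<open>X\<close> is any set of vertices at
  distance \<open>0\<close> from \<open>r\<close>, every join for the terminal set \<open>S\<close> modified at \<open>r\<close> and at all of \<open>X\<close> has
  at least as many edges as a minimum join of \<open>(H, S)\<close>. Hence a join of the synthesis, which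
  restricts to a join of the skeleton and to joins of this kind in the teeth, is at least as large
  as a minimum join of \<open>G\<close> together with minimum joins of all \<open>(H v, S v)\<close>. Minimum joins of the comb
  have exactly one edge at each tooth vertex and extend to joins attaining this bound; the minimum
  joins are the cases of equality.

  The estimate is proved by induction over \<open>0/1\<close> edge lengths in which every cycle has even length,
  a substitute for contractions. Let \<open>g x\<close> be the least length of a join for \<open>U\<close> modified at \<open>x\<close>
  (where \<open>U\<close> is \<open>S\<close> modified at \<open>r\<close>), and let \<open>Z\<close> be a component, with respect to the edges of
  length \<open>0\<close>, on which \<open>g\<close> is minimum. The cut of \<open>Z\<close> meets every join in question an odd number of
  times, and setting its edges to length \<open>0\<close> lowers the maximum of \<open>g\<close> by exactly \<open>1\<close>.
\<close>

section \<open>Joins, parity and paths\<close>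

text \<open>The boundary of \<open>F\<close> modulo 2. It ranges over the whole type rather than
  over \<open>verts G\<close>, so prescribing terminals becomes one equation between sets.\<close>

definition odd_verts :: "('v, 'e) mgraph \<Rightarrow> 'e set \<Rightarrow> 'v set" where
  "odd_verts G F = {v. odd (card {e \<in> F. v \<in> ends G e})}"

definition adj :: "('v, 'e) mgraph \<Rightarrow> 'e set \<Rightarrow> ('v \<times> 'v) set" where
  "adj G N = {(x, y). \<exists>e\<in>N. ends G e = {x, y}}"

text \<open>A constant of its own, since \<open>sym_diff\<close> abbreviates a union of differences:
  terms stay intact under simp, and boundary computations reduce to rewriting with
  \<open>symdiff_ac\<close>.\<close>

definition symdiff :: "'a set \<Rightarrow> 'a set \<Rightarrow> 'a set" (infixl "\<triangle>" 65) where
  "X \<triangle> Y = sym_diff X Y"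

lemma in_symdiff [simp]: "x \<in> X \<triangle> Y \<longleftrightarrow> (x \<in> X \<longleftrightarrow> x \<notin> Y)"
  by (auto simp: symdiff_def)

lemma finite_symdiff [simp]: "finite X \<Longrightarrow> finite Y \<Longrightarrow> finite (X \<triangle> Y)"
  by (simp add: symdiff_def)

lemma symdiff_subset: "X \<subseteq> Z \<Longrightarrow> Y \<subseteq> Z \<Longrightarrow> X \<triangle> Y \<subseteq> Z"
  by (auto simp: symdiff_def)

lemma symdiff_self [simp]: "X \<triangle> X = {}"
  and symdiff_empty [simp]: "X \<triangle> {} = X" "{} \<triangle> X = X"
  and symdiff_left_self [simp]: "X \<triangle> (X \<triangle> Y) = Y"
  by (auto simp: symdiff_def)

lemma symdiff_commute: "X \<triangle> Y = Y \<triangle> X"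
  and symdiff_left_commute: "X \<triangle> (Y \<triangle> Z) = Y \<triangle> (X \<triangle> Z)"
  and symdiff_assoc: "X \<triangle> Y \<triangle> Z = X \<triangle> (Y \<triangle> Z)"
  by (auto simp: set_eq_iff)

lemmas symdiff_ac = symdiff_assoc symdiff_commute symdiff_left_commute

lemma pair_symdiff: "x \<noteq> y \<Longrightarrow> {x, y} = {x} \<triangle> {y}"
  by (auto simp: set_eq_iff)

lemma card_symdiff_parity:
  assumes "finite X" "finite Y"
  shows "even (card (X \<triangle> Y)) \<longleftrightarrow> (even (card X) \<longleftrightarrow> even (card Y))"
proof -
  have "card (X \<triangle> Y) = card (X - Y) + card (Y - X)"
    using assms unfolding symdiff_def by (intro card_Un_disjoint) auto
  moreover have "card X = card (X - Y) + card (X \<inter> Y)" "card Y = card (Y - X) + card (X \<inter> Y)"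
    using assms card_Int_Diff[of X Y] card_Int_Diff[of Y X] by (auto simp: Int_commute)
  ultimately show ?thesis by auto
qed

section \<open>Boundaries of edge sets and joins\<close>

lemma odd_verts_empty [simp]: "odd_verts G {} = {}"
  by (simp add: odd_verts_def)

lemma odd_verts_single [simp]: "odd_verts G {e} = ends G e"
  by (auto simp: odd_verts_def conj_commute Collect_conv_if)

lemma odd_verts_symdiff [simp]:
  assumes "finite X" "finite Y"
  shows "odd_verts G (X \<triangle> Y) = odd_verts G X \<triangle> odd_verts G Y"
proof (rule set_eqI)
  fix v
  have "{e \<in> X \<triangle> Y. v \<in> ends G e} =
        {e \<in> X. v \<in> ends G e} \<triangle> {e \<in> Y. v \<in> ends G e}"
    by auto
  then show "v \<in> odd_verts G (X \<triangle> Y) \<longleftrightarrow> v \<in> odd_verts G X \<triangle> odd_verts G Y"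
    using card_symdiff_parity[of "{e \<in> X. v \<in> ends G e}" "{e \<in> Y. v \<in> ends G e}"] assms
    unfolding odd_verts_def by auto
qed

lemma odd_verts_subset_verts:
  assumes "is_mgraph G" "F \<subseteq> edges G"
  shows "odd_verts G F \<subseteq> verts G"
proof
  fix v assume "v \<in> odd_verts G F"
  then have "{e \<in> F. v \<in> ends G e} \<noteq> {}"
    by (auto simp: odd_verts_def simp del: Collect_empty_eq)
  then show "v \<in> verts G"
    using assms by (auto simp: is_mgraph_def)
qed

text \<open>The boundary of a set of edges of \<open>G\<close> lies inside \<open>verts G\<close>,
  so parities at the vertices of \<open>G\<close> determine it.\<close>

lemma is_join_iff:
  assumes "is_mgraph G" "T \<subseteq> verts G"
  shows "is_join G T F \<longleftrightarrow> F \<subseteq> edges G \<and> odd_verts G F = T"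
  using odd_verts_subset_verts[OF assms(1), of F] assms(2)
  by (auto simp: is_join_def odd_verts_def)

lemma minimum_join_iff:
  "minimum_join G T F \<longleftrightarrow> is_join G T F \<and> (\<forall>F'. is_join G T F' \<longrightarrow> card F \<le> card F')"
  by (auto simp: minimum_join_def is_arg_min_def not_less)

lemma minimum_join_exists:
  assumes "is_join G T F"
  obtains F' where "minimum_join G T F'"
  using ex_has_least_nat[of "is_join G T" F card] assms
  by (auto simp: minimum_join_iff)

text \<open>Adding an edge changes both parities by that of the number of its ends in
  \<open>K\<close>, which is at most 2 and hence odd exactly when it is 1. Finiteness of the
  boundary is carried along for \<open>card_symdiff_parity\<close>.\<close>

lemma handshake:
  assumes "finite F" "\<And>e. e \<in> F \<Longrightarrow> card (ends G e) = 2"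
  shows "even (card (odd_verts G F \<inter> K)) \<longleftrightarrow> even (card {e \<in> F. card (ends G e \<inter> K) = 1})"
proof -
  have "(even (card (odd_verts G F \<inter> K)) \<longleftrightarrow> even (card {e \<in> F. card (ends G e \<inter> K) = 1}))
     \<and> finite (odd_verts G F)"
    using assms
  proof (induction F rule: finite_induct)
    case empty
    then show ?case by simp
  next
    case (insert e F)
    let ?C = "\<lambda>F. {e \<in> F. card (ends G e \<inter> K) = 1}"
    have e2: "card (ends G e) = 2" using insert.prems by simp
    then have fe: "finite (ends G e)" by (metis card.infinite zero_neq_numeral)
    have ins: "insert e F = F \<triangle> {e}" using insert.hyps by (auto simp: set_eq_iff)
    have ov: "odd_verts G (insert e F) = odd_verts G F \<triangle> ends G e"
      unfolding ins by (subst odd_verts_symdiff) (use insert.hyps in auto)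
    have IH: "even (card (odd_verts G F \<inter> K)) \<longleftrightarrow> even (card (?C F))" "finite (odd_verts G F)"
      using insert.IH insert.prems by auto
    have "odd_verts G (insert e F) \<inter> K = odd_verts G F \<inter> K \<triangle> ends G e \<inter> K"
      unfolding ov by (auto simp: set_eq_iff)
    then have "even (card (odd_verts G (insert e F) \<inter> K)) \<longleftrightarrow>
        (even (card (odd_verts G F \<inter> K)) \<longleftrightarrow> even (card (ends G e \<inter> K)))"
      using card_symdiff_parity[of "odd_verts G F \<inter> K" "ends G e \<inter> K"] IH(2) fe by simp
    moreover have "card (ends G e \<inter> K) \<le> 2"
      using card_mono[OF fe, of "ends G e \<inter> K"] e2 by simp
    then have "even (card (ends G e \<inter> K)) \<longleftrightarrow> card (ends G e \<inter> K) \<noteq> 1"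
      by (auto simp: le_Suc_eq numeral_2_eq_2)
    moreover have "?C (insert e F) = (if card (ends G e \<inter> K) = 1 then insert e (?C F) else ?C F)"
      by auto
    ultimately show ?case
      using IH insert.hyps fe by (auto simp: ov)
  qed
  then show ?thesis ..
qed

section \<open>Paths and connectivity\<close>

lemma is_path_odd_verts:
  assumes "is_path G x vs es y"
  shows "odd_verts G (set es) = {x} \<triangle> {y}"
proof -
  \<comment> \<open>The second conjunct serves the induction: \<open>x\<close> does not recur later
    on the path, so the first edge is not among the later ones and does not cancel.\<close>
  have "odd_verts G (set es) = {x} \<triangle> {y} \<and> (\<forall>e\<in>set es. ends G e \<subseteq> set vs)"
    using assms
  proof (induction es arbitrary: x vs)
    case Nil
    then obtain v where "vs = [v]" by (auto simp: is_path_def length_Suc_conv)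
    then show ?case using Nil by (auto simp: is_path_def)
  next
    case (Cons e es)
    then obtain vs' where vs: "vs = x # vs'" and len: "length vs' = Suc (length es)"
      by (auto simp: is_path_def length_Suc_conv)
    have e: "ends G e = {x, hd vs'}"
      using Cons.prems len unfolding is_path_def vs
      by (cases vs') (auto dest!: spec[of _ 0])
    have "is_path G (hd vs') vs' es y"
      using Cons.prems len unfolding is_path_def vs
      by (cases vs') (auto dest: spec[of _ "Suc _"] split: if_splits)
    from Cons.IH[OF this] have IH: "odd_verts G (set es) = {hd vs'} \<triangle> {y}"
      "\<forall>e\<in>set es. ends G e \<subseteq> set vs'" by auto
    have x: "x \<notin> set vs'" using Cons.prems by (auto simp: is_path_def vs)
    then have enotin: "e \<notin> set es" using IH(2) e by auto
    have "hd vs' \<in> set vs'" "y \<in> set vs'"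
      using len Cons.prems by (auto simp: is_path_def vs split: if_splits)
    moreover have "set (e # es) = {e} \<triangle> set es" using enotin by (auto simp: set_eq_iff)
    then have "odd_verts G (set (e # es)) = ends G e \<triangle> odd_verts G (set es)"
      by (metis odd_verts_symdiff odd_verts_single List.finite_set finite.emptyI finite.insertI)
    ultimately show ?case
      using IH enotin e x by (auto simp: vs)
  qed
  then show ?thesis ..
qed

text \<open>A new edge is prepended unless its start \<open>x\<close> already lies on the path; then
  the part of the path from \<open>x\<close> on is kept.\<close>

lemma is_path_exists:
  assumes "(x, y) \<in> (adj G N)\<^sup>*" "is_mgraph G" "N \<subseteq> edges G" "y \<in> verts G"
  shows "\<exists>vs es. is_path G x vs es y \<and> set es \<subseteq> N"
  using assms(1)
proof (induction rule: converse_rtrancl_induct)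
  case base
  have "is_path G y [y] [] y" using assms by (simp add: is_path_def)
  then show ?case by (metis empty_subsetI list.set(1))
next
  case (step x x')
  then obtain e vs es where e: "e \<in> N" "ends G e = {x, x'}"
    and p: "is_path G x' vs es y" "set es \<subseteq> N"
    by (auto simp: adj_def)
  show ?case
  proof (cases "x \<in> set vs")
    case False
    have "ends G e \<subseteq> verts G" using e assms(2,3) unfolding is_mgraph_def by blast
    then have "x \<in> verts G" using e by simp
    have "is_path G x (x # vs) (e # es) y"
      unfolding is_path_def
    proof (intro conjI allI impI)
      fix i assume i: "i < length (e # es)"
      have "vs ! 0 = x'" using p(1) by (cases vs) (auto simp: is_path_def)
      then show "ends G ((e # es) ! i) = {(x # vs) ! i, (x # vs) ! Suc i}"
        using p(1) e i by (cases i) (auto simp: is_path_def)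
      show "(e # es) ! i \<in> edges G"
        using p(1) e i assms(3) by (cases i) (auto simp: is_path_def)
    qed (use p(1) False \<open>x \<in> verts G\<close> in \<open>auto simp: is_path_def\<close>)
    then show ?thesis using p e by (metis insert_subset list.set(2))
  next
    case True
    then obtain i where i: "i < length vs" "vs ! i = x" by (auto simp: in_set_conv_nth)
    have "is_path G x (drop i vs) (drop i es) y"
      unfolding is_path_def
    proof (intro conjI allI impI)
      show "set (drop i vs) \<subseteq> verts G"
        using p(1) set_drop_subset[of i vs] by (auto simp: is_path_def)
    qed (use p i in \<open>simp_all add: is_path_def hd_drop_conv_nth Suc_diff_le\<close>)
    then show ?thesis using p(2) by (meson dual_order.trans set_drop_subset)
  qed
qed

lemma connecting_edges:
  assumes "(x, y) \<in> (adj G N)\<^sup>*" "is_mgraph G" "N \<subseteq> edges G" "y \<in> verts G"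
  obtains P where "P \<subseteq> N" "odd_verts G P = {x} \<triangle> {y}"
proof -
  obtain vs es where "is_path G x vs es y" "set es \<subseteq> N"
    using is_path_exists[OF assms] by auto
  then show ?thesis using that is_path_odd_verts by metis
qed

lemma sym_adj: "(x, y) \<in> (adj G N)\<^sup>* \<Longrightarrow> (y, x) \<in> (adj G N)\<^sup>*"
  by (rule symD[OF sym_rtrancl]) (auto simp: adj_def sym_def insert_commute)

lemma edge_ends:
  assumes "is_mgraph G" "e \<in> edges G"
  obtains x y where "ends G e = {x, y}" "x \<noteq> y" "x \<in> verts G" "y \<in> verts G"
proof -
  have "card (ends G e) = 2" "ends G e \<subseteq> verts G"
    using assms unfolding is_mgraph_def by blast+
  then show ?thesis using that by (auto simp: card_2_iff)
qed

section \<open>Cuts\<close>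

lemma in_edge_cut:
  assumes "e \<in> edges G" "ends G e = {x, y}" "x \<noteq> y"
  shows "e \<in> edge_cut G K \<longleftrightarrow> (x \<in> K \<longleftrightarrow> y \<notin> K)"
  using assms by (auto simp: edge_cut_def Int_insert_left)

lemma edge_cut_symdiff:
  assumes "is_mgraph G"
  shows "edge_cut G (K \<triangle> Z) = edge_cut G K \<triangle> edge_cut G Z"
proof (rule set_eqI)
  fix e
  show "e \<in> edge_cut G (K \<triangle> Z) \<longleftrightarrow> e \<in> edge_cut G K \<triangle> edge_cut G Z"
  proof (cases "e \<in> edges G")
    case True
    then obtain x y where "ends G e = {x, y}" "x \<noteq> y"
      using edge_ends[OF assms] by metis
    then show ?thesis using True by (auto simp: in_edge_cut)
  qed (simp add: edge_cut_def)
qed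

lemma edge_cut_subset: "edge_cut G K \<subseteq> edges G"
  by (auto simp: edge_cut_def)

lemma finite_join: "is_mgraph G \<Longrightarrow> F \<subseteq> edges G \<Longrightarrow> finite F"
  unfolding is_mgraph_def using finite_subset by auto

text \<open>The source of the parity arguments below: the boundary alone decides how often, modulo
  2, an edge set crosses a cut.\<close>

lemma cut_parity:
  assumes "is_mgraph G" "F \<subseteq> edges G"
  shows "even (card (F \<inter> edge_cut G K)) \<longleftrightarrow> even (card (odd_verts G F \<inter> K))"
proof -
  have "F \<inter> edge_cut G K = {e \<in> F. card (ends G e \<inter> K) = 1}"
    using assms(2) by (auto simp: edge_cut_def)
  moreover have "\<And>e. e \<in> F \<Longrightarrow> card (ends G e) = 2"
    using assms unfolding is_mgraph_def by blast
  ultimately show ?thesis using handshake[of F G K] finite_join[OF assms] by simp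
qed

lemma odd_card_pair: "odd (card (({x} \<triangle> {y}) \<inter> K)) \<longleftrightarrow> (x \<in> K \<longleftrightarrow> y \<notin> K)"
  by (cases "x = y") (simp_all flip: pair_symdiff add: Int_insert_left)

text \<open>Flipping \<open>P\<close> in \<open>F\<close> trades \<open>P \<inter> F\<close> for
  \<open>P \<inter> J\<close>. The additive form avoids truncated subtraction; \<open>W\<close>
  selects the edges that are counted.\<close>

lemma card_exchange:
  assumes "finite F" "finite J" "P \<subseteq> J \<triangle> F"
  shows "card ((F \<triangle> P) \<inter> W) + card (P \<inter> F \<inter> W) = card (F \<inter> W) + card (P \<inter> J \<inter> W)"
proof -
  have "(F \<triangle> P) \<inter> W = (F \<inter> W - P) \<union> P \<inter> J \<inter> W"
    using assms(3) by (auto simp: subset_iff)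
  moreover have "card ((F \<inter> W - P) \<union> P \<inter> J \<inter> W) =
      card (F \<inter> W - P) + card (P \<inter> J \<inter> W)"
    by (rule card_Un_disjoint) (use assms in \<open>auto simp: subset_iff\<close>)
  moreover have "card (F \<inter> W - P) + card (P \<inter> F \<inter> W) = card (F \<inter> W)"
    using card_Int_Diff[of "F \<inter> W" P] assms(1) by (simp add: Int_ac)
  ultimately show ?thesis by simp
qed

section \<open>Joins with terminals on the top level\<close>

text \<open>
  Edges in the cut of \<open>K\<close> have length \<open>1\<close>, all others length \<open>0\<close>; cuts are exactly the \<open>0/1\<close> lengths
  for which every cycle is even.
\<close>

context
  fixes G :: "('v, 'e) mgraph" and K Z U :: "'v set" and b :: 'v and F :: "'e set"
  assumes G: "is_mgraph G" and b: "b \<in> verts G"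
    and F: "F \<subseteq> edges G" "odd_verts G F = U \<triangle> {b}"
    and F_min: "\<forall>y\<in>verts G. \<forall>J\<subseteq>edges G. odd_verts G J = U \<triangle> {y} \<longrightarrow>
      card (F \<inter> edge_cut G K) \<le> card (J \<inter> edge_cut G K)"
    and Z_def: "Z = (adj G (edges G - edge_cut G K))\<^sup>* `` {b}"
begin

section \<open>The component on which the least join length is minimum, and its cut\<close>

lemma base_in_component: "b \<in> Z"
  by (simp add: Z_def)

lemma component_cut_subset: "edge_cut G Z \<subseteq> edge_cut G K"
proof
  fix e assume e: "e \<in> edge_cut G Z"
  then have eE: "e \<in> edges G" by (simp add: edge_cut_def)
  then obtain x y where xy: "ends G e = {x, y}" "x \<noteq> y" using edge_ends[OF G] by metis
  show "e \<in> edge_cut G K"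
  proof (rule ccontr)
    assume "e \<notin> edge_cut G K"
    then have "(x, y) \<in> adj G (edges G - edge_cut G K)" "(y, x) \<in> adj G (edges G - edge_cut G K)"
      using eE xy by (auto simp: adj_def insert_commute)
    then have "x \<in> Z \<longleftrightarrow> y \<in> Z"
      unfolding Z_def by (auto intro: rtrancl_into_rtrancl)
    then show False using e in_edge_cut[OF eE xy] by blast
  qed
qed

lemma component_path:
  assumes "z \<in> Z" "z \<in> verts G"
  obtains P where "P \<subseteq> edges G - edge_cut G K" "odd_verts G P = {b} \<triangle> {z}"
  using assms connecting_edges[of b z G "edges G - edge_cut G K"] G by (auto simp: Z_def)

text \<open>Edges of length 0 lead from \<open>b\<close> to \<open>z\<close> without crossing the
  cut of \<open>K\<close>, so parity puts both vertices on the same side.\<close>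

lemma component_colour:
  assumes "z \<in> Z" "z \<in> verts G"
  shows "z \<in> K \<longleftrightarrow> b \<in> K"
proof -
  obtain P where P: "P \<subseteq> edges G - edge_cut G K" "odd_verts G P = {b} \<triangle> {z}" using component_path[OF assms] .
  then have "P \<inter> edge_cut G K = {}" by auto
  then show ?thesis
    using cut_parity[OF G, of P K] P odd_card_pair[of b z K] by auto
qed

lemma component_cut_edge:
  assumes "e \<in> edge_cut G Z"
  obtains z y where "ends G e = {z, y}" "z \<noteq> y" "z \<in> Z" "y \<notin> Z" "z \<in> verts G" "y \<in> verts G"
    "y \<in> K \<longleftrightarrow> b \<notin> K"
proof -
  have eE: "e \<in> edges G" using assms by (simp add: edge_cut_def)
  then obtain x y where xy: "ends G e = {x, y}" "x \<noteq> y" "x \<in> verts G" "y \<in> verts G"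
    using edge_ends[OF G] by metis
  have iff: "x \<in> Z \<longleftrightarrow> y \<notin> Z" "x \<in> K \<longleftrightarrow> y \<notin> K"
    using in_edge_cut[OF eE xy(1,2)] assms component_cut_subset by auto
  show ?thesis
  proof (cases "x \<in> Z")
    case True
    show ?thesis by (rule that[of x y]) (use True xy iff component_colour[of x] in auto)
  next
    case False
    show ?thesis by (rule that[of y x]) (use False xy iff component_colour[of y] in auto)
  qed
qed

text \<open>If \<open>F\<close> used such an edge, deleting it and moving the extra terminal from
  \<open>b\<close> to its outer end, with the help of edges of length 0, would give a join shorter
  by 1, against \<open>F_min\<close>.\<close>

lemma minimum_avoids_component_cut: "F \<inter> edge_cut G Z = {}"
proof (rule ccontr)
  assume "F \<inter> edge_cut G Z \<noteq> {}"
  then obtain e where e: "e \<in> F" "e \<in> edge_cut G Z" by auto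
  obtain z y where zy: "ends G e = {z, y}" "z \<noteq> y" "z \<in> Z" "z \<in> verts G" "y \<in> verts G"
    by (rule component_cut_edge[OF e(2)])
  obtain P where P: "P \<subseteq> edges G - edge_cut G K" "odd_verts G P = {b} \<triangle> {z}"
    using component_path[OF zy(3,4)] .
  have fin: "finite F" "finite P" using F(1) P(1) finite_join[OF G] by blast+
  have "odd_verts G (F \<triangle> {e} \<triangle> P) = U \<triangle> {y}"
    using fin zy by (simp add: F P pair_symdiff symdiff_ac)
  moreover have "F \<triangle> {e} \<triangle> P \<subseteq> edges G" using F P e by (intro symdiff_subset) auto
  ultimately have "card (F \<inter> edge_cut G K) \<le> card ((F \<triangle> {e} \<triangle> P) \<inter> edge_cut G K)"
    using F_min zy by blast
  also have "(F \<triangle> {e} \<triangle> P) \<inter> edge_cut G K = F \<inter> edge_cut G K - {e}" using P e component_cut_subset by auto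
  also have "card \<dots> < card (F \<inter> edge_cut G K)"
    using e component_cut_subset fin by (intro card_Diff1_less) auto
  finally show False by simp
qed

text \<open>The only odd vertex of \<open>J \<triangle> F\<close> in \<open>Z\<close> is
  \<open>b\<close>, so this set crosses the cut of \<open>Z\<close> oddly often, and
  \<open>F\<close> does not cross it at all.\<close>

lemma odd_component_cut:
  assumes "J \<subseteq> edges G" "odd_verts G J = U \<triangle> X" "X \<inter> Z = {}"
  shows "odd (card (J \<inter> edge_cut G Z))"
proof -
  have JF: "J \<triangle> F \<subseteq> edges G" using F assms by (intro symdiff_subset)
  have "odd_verts G (J \<triangle> F) = X \<triangle> {b}"
    using finite_join[OF G] assms F by (simp add: symdiff_ac)
  then have "odd_verts G (J \<triangle> F) \<inter> Z = {b}" using assms base_in_component by auto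
  then have "odd (card ((J \<triangle> F) \<inter> edge_cut G Z))" using cut_parity[OF G JF, of Z] by simp
  moreover have "(J \<triangle> F) \<inter> edge_cut G Z = J \<inter> edge_cut G Z" using minimum_avoids_component_cut by auto
  ultimately show ?thesis by simp
qed

text \<open>The number of crossings is odd and not 1. If the component of
  \<open>J \<triangle> F\<close> outside \<open>Z\<close> at one crossing meets no other, it
  contains \<open>x\<close>. The component at any further crossing then either is the same one or
  misses \<open>x\<close> and meets an even number of crossings, hence a second one.\<close>

lemma cut_edges_linked:
  assumes "J \<subseteq> edges G" "odd_verts G J = U \<triangle> {x}" "x \<notin> Z" "card (J \<inter> edge_cut G Z) \<noteq> 1"
    and N_def: "N = {e \<in> J \<triangle> F. ends G e \<inter> Z = {}}"
  obtains e f y y' where "e \<in> J \<inter> edge_cut G Z" "f \<in> J \<inter> edge_cut G Z" "e \<noteq> f"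
    "y \<in> ends G e - Z" "y' \<in> ends G f - Z" "(y, y') \<in> (adj G N)\<^sup>*"
proof -
  note concl = that
  define D where "D = J \<inter> edge_cut G Z"
  define cls where "cls = (\<lambda>y. (adj G N)\<^sup>* `` {y})"
  have finD: "finite D" unfolding D_def using finite_join[OF G assms(1)] by simp
  have oddD: "odd (card D)" unfolding D_def using odd_component_cut[OF assms(1,2)] assms(3) by simp
  have JF: "J \<triangle> F \<subseteq> edges G" using F assms by (intro symdiff_subset)
  have bd: "odd_verts G (J \<triangle> F) = {x} \<triangle> {b}"
    using finite_join[OF G] assms F by (simp add: symdiff_ac)
  have cls_Z: "cls y \<inter> Z = {}" if "y \<notin> Z" for y
  proof -
    have "v \<notin> Z" if "(y, v) \<in> (adj G N)\<^sup>*" for v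
      using that \<open>y \<notin> Z\<close> by (cases rule: rtranclE) (auto simp: adj_def N_def)
    then show ?thesis by (auto simp: cls_def)
  qed
  \<comment> \<open>Cut parity for the component \<open>cls y\<close>: edges of
    \<open>J \<triangle> F\<close> leaving it lead into \<open>Z\<close>, so they are crossings in
    \<open>D\<close>, and the odd vertex \<open>b\<close> lies in \<open>Z\<close>.\<close>
  have par: "odd (card {e \<in> D. ends G e \<inter> cls y \<noteq> {}}) \<longleftrightarrow> x \<in> cls y" if y: "y \<notin> Z" for y
  proof -
    have "(J \<triangle> F) \<inter> edge_cut G (cls y) = {e \<in> D. ends G e \<inter> cls y \<noteq> {}}"
    proof (rule set_eqI)
      fix e
      show "e \<in> (J \<triangle> F) \<inter> edge_cut G (cls y) \<longleftrightarrow> e \<in> {e \<in> D. ends G e \<inter> cls y \<noteq> {}}"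
      proof (cases "e \<in> J \<triangle> F")
        case False
        then show ?thesis using minimum_avoids_component_cut by (auto simp: D_def)
      next
        case True
        then have eE: "e \<in> edges G" using JF by blast
        obtain u v where uv: "ends G e = {u, v}" "u \<noteq> v" using edge_ends[OF G eE] by metis
        have iff: "u \<in> cls y \<longleftrightarrow> v \<in> cls y" if "u \<notin> Z" "v \<notin> Z"
        proof -
          have "(u, v) \<in> adj G N" "(v, u) \<in> adj G N"
            using True that uv by (auto simp: adj_def N_def insert_commute)
          then show ?thesis unfolding cls_def by (auto intro: rtrancl_into_rtrancl)
        qed
        have "e \<in> D \<longleftrightarrow> e \<in> edge_cut G Z" using True minimum_avoids_component_cut by (auto simp: D_def)
        then show ?thesis
          using True iff cls_Z[OF y] uv in_edge_cut[OF eE uv] by auto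
      qed
    qed
    moreover have "odd_verts G (J \<triangle> F) \<inter> cls y = {x} \<inter> cls y"
      using bd cls_Z[OF y] base_in_component by auto
    ultimately have "odd (card {e \<in> D. ends G e \<inter> cls y \<noteq> {}}) \<longleftrightarrow> odd (card ({x} \<inter> cls y))"
      using cut_parity[OF G JF, of "cls y"] by simp
    then show ?thesis by (cases "x \<in> cls y") auto
  qed
  obtain e where e: "e \<in> D" using oddD by (cases "D = {}") auto
  obtain y where y: "y \<in> ends G e" "y \<notin> Z"
    using e component_cut_edge[of e] unfolding D_def by blast
  have self: "v \<in> cls v" for v by (simp add: cls_def)
  have linked: thesis if efy: "e \<in> D" "f \<in> D" "e \<noteq> f" "y \<in> ends G e" "y \<notin> Z" "ends G f \<inter> cls y \<noteq> {}" for e f y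
  proof -
    obtain y' where y': "y' \<in> ends G f" "y' \<in> cls y" using efy(6) by blast
    then have "y' \<notin> Z" using cls_Z[OF \<open>y \<notin> Z\<close>] by blast
    then show thesis
      using efy y' by (intro concl[of e f y y']) (auto simp: D_def cls_def)
  qed
  show thesis
  proof (cases "{f \<in> D. ends G f \<inter> cls y \<noteq> {}} = {e}")
    case False
    then obtain f where "f \<in> D" "f \<noteq> e" "ends G f \<inter> cls y \<noteq> {}"
      using e y self[of y] by blast
    then show thesis using linked[of e f y] e y by blast
  next
    case True
    then have xy: "x \<in> cls y" using par[OF y(2)] by simp
    have "D \<noteq> {e}" using assms(4) by (auto simp: D_def)
    then obtain f where f: "f \<in> D" "f \<noteq> e" using e by auto
    obtain y' where y': "y' \<in> ends G f" "y' \<notin> Z"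
      using f(1) component_cut_edge[of f] unfolding D_def by blast
    have "y' \<notin> cls y" using True f y' by blast
    then have "x \<notin> cls y'"
      using xy unfolding cls_def by (auto dest: sym_adj intro: rtrancl_trans)
    then have "{g \<in> D. ends G g \<inter> cls y' \<noteq> {}} \<noteq> {f}" using par[OF y'(2)] by auto
    then obtain g where "g \<in> D" "g \<noteq> f" "ends G g \<inter> cls y' \<noteq> {}"
      using f y' self[of y'] by blast
    then show thesis using linked[of f g y'] f y' by blast
  qed
qed

lemma component_join:
  assumes "z \<in> Z" "z \<in> verts G"
  obtains J where "J \<subseteq> edges G" "odd_verts G J = U \<triangle> {z}" "card (J \<inter> edge_cut G K) = card (F \<inter> edge_cut G K)"
proof -
  obtain P where P: "P \<subseteq> edges G - edge_cut G K" "odd_verts G P = {b} \<triangle> {z}" using component_path[OF assms] .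
  have "finite F" "finite P" using F(1) P(1) finite_join[OF G] by blast+
  then have "odd_verts G (F \<triangle> P) = U \<triangle> {z}" by (simp add: F P symdiff_ac)
  moreover have "F \<triangle> P \<subseteq> edges G" using F P by (intro symdiff_subset) auto
  moreover have "(F \<triangle> P) \<inter> edge_cut G K = F \<inter> edge_cut G K" using P by auto
  ultimately show ?thesis using that by simp
qed

text \<open>Setting the cut of \<open>Z\<close> to length 0 gives the lengths of another cut, so the
  induction in \<open>level_bound\<close> stays within lengths of this form.\<close>

lemma edge_cut_flip_component:
  "edge_cut G (K \<triangle> Z) = edge_cut G K - edge_cut G Z"
  using edge_cut_symdiff[OF G, of K Z] component_cut_subset by (auto simp: set_eq_iff)

text \<open>Giving the cut of \<open>Z\<close> length 0 thus lowers the least join length at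
  \<open>x\<close> by at most 1. Two linked crossings are removed at a time without increasing the
  new length, until a single one is left.\<close>

lemma component_cut_reduce:
  assumes "J \<subseteq> edges G" "odd_verts G J = U \<triangle> {x}" "x \<notin> Z"
  shows "\<exists>J'\<subseteq>edges G. odd_verts G J' = U \<triangle> {x} \<and> card (J' \<inter> edge_cut G K) \<le> card (J \<inter> (edge_cut G K - edge_cut G Z)) + 1"
  using assms
proof (induction "card (J \<inter> edge_cut G Z)" arbitrary: J rule: less_induct)
  case (less J)
  let ?D = "edge_cut G Z"
  have finJ: "finite J" "finite F" using less.prems F finite_join[OF G] by auto
  show ?case
  proof (cases "card (J \<inter> ?D) = 1")
    case True
    have "J \<inter> edge_cut G K = J \<inter> (edge_cut G K - ?D) \<union> J \<inter> ?D" using component_cut_subset by blast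
    then have "card (J \<inter> edge_cut G K) \<le> card (J \<inter> (edge_cut G K - ?D)) + 1"
      using card_Un_le[of "J \<inter> (edge_cut G K - ?D)" "J \<inter> ?D"] True by simp
    then show ?thesis using less.prems by blast
  next
    case False
    define N where "N = {e \<in> J \<triangle> F. ends G e \<inter> Z = {}}"
    obtain e f y y' where ef: "e \<in> J \<inter> ?D" "f \<in> J \<inter> ?D" "e \<noteq> f"
      and y: "y \<in> ends G e - Z" "y' \<in> ends G f - Z" and link: "(y, y') \<in> (adj G N)\<^sup>*"
      by (rule cut_edges_linked[OF less.prems False N_def])
    obtain z where z: "ends G e = {z, y}" "z \<noteq> y" "z \<in> Z" "z \<in> verts G"
      by (rule component_cut_edge[of e]) (use ef y in auto)
    obtain z' where z': "ends G f = {z', y'}" "z' \<noteq> y'" "z' \<in> Z" "z' \<in> verts G"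
        "y' \<in> verts G" "y' \<in> K \<longleftrightarrow> b \<notin> K"
      by (rule component_cut_edge[of f]) (use ef y in auto)
    have NE: "N \<subseteq> edges G"
      using less.prems(1) F(1) by (auto simp: N_def)
    obtain P where P: "P \<subseteq> N" "odd_verts G P = {y} \<triangle> {y'}"
      by (rule connecting_edges[OF link G NE z'(5)])
    obtain Q where Q: "Q \<subseteq> edges G - edge_cut G K" "odd_verts G Q = {b} \<triangle> {z}" using component_path[OF z(3,4)] .
    obtain Q' where Q': "Q' \<subseteq> edges G - edge_cut G K" "odd_verts G Q' = {b} \<triangle> {z'}" using component_path[OF z'(3,4)] .
    have fin: "finite P" "finite Q" "finite Q'"
      using P(1) NE Q(1) Q'(1) finite_join[OF G] by blast+
    have PD: "P \<inter> ?D = {}"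
    proof -
      have "g \<notin> ?D" if "g \<in> P" for g
        using that P(1) by (auto simp: N_def edge_cut_def)
      then show ?thesis by blast
    qed
    have e_notin: "e \<notin> F" "e \<notin> P" "f \<notin> P" "e \<in> edge_cut G K" "f \<in> edge_cut G K" "e \<in> edges G" "f \<in> edges G"
      using ef minimum_avoids_component_cut PD component_cut_subset less.prems(1) by blast+
    have PJF: "P \<subseteq> J \<triangle> F" using P(1) by (auto simp: N_def)

    \<comment> \<open>A path leaving \<open>b\<close> along \<open>e\<close> and \<open>P\<close> ends one level above the minimum, so flipping
      \<open>P\<close> does not decrease the weight of \<open>F\<close>, and hence does not increase that of \<open>J\<close>.\<close>
    define R where "R = F \<triangle> P \<triangle> {e} \<triangle> Q"
    have R: "R \<subseteq> edges G" unfolding R_def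
      using F(1) P(1) NE Q(1) e_notin by (intro symdiff_subset) auto
    have bdR: "odd_verts G R = U \<triangle> {y'}"
      unfolding R_def using finJ fin z by (simp add: F P Q pair_symdiff symdiff_ac)
    have "odd_verts G (R \<triangle> F) = {b} \<triangle> {y'}"
      using bdR finite_join[OF G R] finJ F by (simp add: symdiff_ac)
    then have "odd (card ((R \<triangle> F) \<inter> edge_cut G K))"
      using cut_parity[OF G symdiff_subset[OF R F(1)], of K] odd_card_pair[of b y' K] z'(6) by simp
    moreover have "(R \<triangle> F) \<inter> edge_cut G K = (R \<inter> edge_cut G K) \<triangle> (F \<inter> edge_cut G K)" by auto
    ultimately have "card (R \<inter> edge_cut G K) \<noteq> card (F \<inter> edge_cut G K)"
      using finite_join[OF G R] finJ by (auto simp: card_symdiff_parity)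
    then have "card (F \<inter> edge_cut G K) < card (R \<inter> edge_cut G K)"
      using F_min[rule_format, OF z'(5) R bdR] by simp
    also have "R \<inter> edge_cut G K = insert e ((F \<triangle> P) \<inter> edge_cut G K)"
      unfolding R_def using Q(1) e_notin by auto
    also have "card \<dots> \<le> card ((F \<triangle> P) \<inter> edge_cut G K) + 1"
      using finJ fin by (simp add: card_insert_if)
    finally have "card (P \<inter> F \<inter> edge_cut G K) \<le> card (P \<inter> J \<inter> edge_cut G K)"
      using card_exchange[OF finJ(2,1) PJF, of "edge_cut G K"] by simp
    \<comment> \<open>As \<open>P\<close> misses the cut of \<open>Z\<close>, old and new lengths
      agree on it, and the comparison carries over to the new ones.\<close>
    moreover have "P \<inter> A \<inter> (edge_cut G K - ?D) = P \<inter> A \<inter> edge_cut G K" for A using PD by blast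
    ultimately have le: "card ((J \<triangle> P) \<inter> (edge_cut G K - ?D)) \<le> card (J \<inter> (edge_cut G K - ?D))"
      using card_exchange[OF finJ(1,2), of P "edge_cut G K - ?D"] PJF by (simp add: symdiff_commute)

    \<comment> \<open>The boundaries of \<open>Q\<close>, \<open>e\<close>, \<open>P\<close>,
      \<open>f\<close> and \<open>Q'\<close> cancel, leading from \<open>b\<close> through
      \<open>z\<close>, \<open>y\<close>, \<open>y'\<close>, \<open>z'\<close> back to
      \<open>b\<close>. So the terminals stay, while both crossings disappear and \<open>Q\<close>,
      \<open>Q'\<close> cost nothing.\<close>
    define J' where "J' = J \<triangle> P \<triangle> {e} \<triangle> {f} \<triangle> Q \<triangle> Q'"
    have "J' \<subseteq> edges G" unfolding J'_def
      using less.prems(1) P(1) NE Q(1) Q'(1) e_notin by (intro symdiff_subset) auto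
    moreover have "odd_verts G J' = U \<triangle> {x}"
      unfolding J'_def using finJ fin z z' less.prems
      by (simp add: P Q Q' pair_symdiff symdiff_ac)
    moreover have "g \<notin> P" "g \<notin> Q" "g \<notin> Q'" if "g \<in> ?D" for g
      using that PD Q(1) Q'(1) component_cut_subset by auto
    then have "J' \<inter> ?D = J \<inter> ?D - {e, f}"
      unfolding J'_def using ef by (auto simp: set_eq_iff)
    then have "J' \<inter> ?D \<subset> J \<inter> ?D" using ef by blast
    then have "card (J' \<inter> ?D) < card (J \<inter> ?D)"
      using finJ by (intro psubset_card_mono) auto
    moreover have "J' \<inter> (edge_cut G K - ?D) = (J \<triangle> P) \<inter> (edge_cut G K - ?D)"
      unfolding J'_def using Q(1) Q'(1) ef by auto
    ultimately obtain I where "I \<subseteq> edges G" "odd_verts G I = U \<triangle> {x}"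
        "card (I \<inter> edge_cut G K) \<le> card ((J \<triangle> P) \<inter> (edge_cut G K - ?D)) + 1"
      using less.hyps[of J'] less.prems(3) by auto
    then show ?thesis using le by (intro exI[of _ I]) auto
  qed
qed

end

text \<open>Here \<open>m\<close> is the maximum over all vertices \<open>x\<close> of the least
  length of a join for \<open>U \<triangle> {x}\<close>, attained throughout \<open>L\<close>. The
  induction is on the number of edges of length 1: zeroing the cut of a minimum component lowers the
  maximum by exactly 1 and the length of \<open>J\<close> by at least 1.\<close>

lemma level_bound:
  assumes "is_mgraph G" "L \<subseteq> verts G" "L \<noteq> {}" "X \<subseteq> L"
    and "\<And>x. x \<in> verts G \<Longrightarrow>
      \<exists>J\<subseteq>edges G. odd_verts G J = U \<triangle> {x} \<and> card (J \<inter> edge_cut G K) \<le> m"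
    and "\<And>x J. x \<in> L \<Longrightarrow> J \<subseteq> edges G \<Longrightarrow> odd_verts G J = U \<triangle> {x} \<Longrightarrow> m \<le> card (J \<inter> edge_cut G K)"
    and "J \<subseteq> edges G" "odd_verts G J = U \<triangle> X"
  shows "m \<le> card (J \<inter> edge_cut G K)"
  using assms(5,6)
proof (induction "card (edge_cut G K)" arbitrary: K m rule: less_induct)
  case (less K m)
  note G = assms(1)
  let ?W = "edge_cut G K"
  define C where "C = {(x, F). x \<in> verts G \<and> F \<subseteq> edges G \<and> odd_verts G F = U \<triangle> {x}}"
  obtain x0 where x0: "x0 \<in> L" "x0 \<in> verts G" using assms(2,3) by auto
  then obtain J0 where "(x0, J0) \<in> C" using less.prems(1)[of x0] by (auto simp: C_def)
  then obtain b F where bF: "(b, F) \<in> C"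
    and least: "\<And>y J. (y, J) \<in> C \<Longrightarrow> card (F \<inter> ?W) \<le> card (J \<inter> ?W)"
    using ex_has_least_nat[of "\<lambda>p. p \<in> C" "(x0, J0)" "\<lambda>p. card (snd p \<inter> ?W)"] by auto
  have b: "b \<in> verts G" and F: "F \<subseteq> edges G" "odd_verts G F = U \<triangle> {b}"
    using bF by (auto simp: C_def)
  have F_min: "\<forall>y\<in>verts G. \<forall>J\<subseteq>edges G. odd_verts G J = U \<triangle> {y} \<longrightarrow>
      card (F \<inter> ?W) \<le> card (J \<inter> ?W)"
    using least by (auto simp: C_def)
  show ?case
  proof (cases "m \<le> card (F \<inter> ?W)")
    case True
    have opt: "\<exists>I\<subseteq>edges G. odd_verts G I = U \<triangle> {x} \<and> card (I \<inter> ?W) = m" if x: "x \<in> verts G" for x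
    proof -
      obtain I where I: "I \<subseteq> edges G" "odd_verts G I = U \<triangle> {x}" "card (I \<inter> ?W) \<le> m"
        using less.prems(1)[OF x] by auto
      then have "card (I \<inter> ?W) = m" using F_min[rule_format, OF x I(1,2)] True by simp
      then show ?thesis using I by auto
    qed
    \<comment> \<open>All least lengths equal \<open>m\<close>, but at the two ends of an edge of
      length 1 they would differ in parity. Without such edges, \<open>m\<close> is 0.\<close>
    have "?W = {}"
    proof (rule ccontr)
      assume "?W \<noteq> {}"
      then obtain e where e: "e \<in> ?W" by auto
      then have eE: "e \<in> edges G" by (simp add: edge_cut_def)
      obtain x y where xy: "ends G e = {x, y}" "x \<noteq> y" "x \<in> verts G" "y \<in> verts G"
        using edge_ends[OF G eE] by metis
      obtain I where I: "I \<subseteq> edges G" "odd_verts G I = U \<triangle> {x}" "card (I \<inter> ?W) = m"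
        using opt[OF xy(3)] by auto
      obtain I' where I': "I' \<subseteq> edges G" "odd_verts G I' = U \<triangle> {y}" "card (I' \<inter> ?W) = m"
        using opt[OF xy(4)] by auto
      have fin: "finite I" "finite I'" using I I' finite_join[OF G] by auto
      have "odd_verts G (I \<triangle> I') = {x} \<triangle> {y}" using I I' fin by (simp add: symdiff_ac)
      then have "odd (card ((I \<triangle> I') \<inter> ?W))"
        using cut_parity[OF G symdiff_subset[OF I(1) I'(1)], of K] odd_card_pair[of x y K]
          in_edge_cut[OF eE xy(1,2)] e by simp
      moreover have "(I \<triangle> I') \<inter> ?W = (I \<inter> ?W) \<triangle> (I' \<inter> ?W)" by auto
      ultimately show False using I(3) I'(3) fin by (auto simp: card_symdiff_parity)
    qed
    then show ?thesis using opt[OF x0(2)] by auto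
  next
    case False
    define Z where "Z = (adj G (edges G - ?W))\<^sup>* `` {b}"
    note ctx = G b F F_min Z_def
    let ?W' = "edge_cut G (K \<triangle> Z)"
    have W': "?W' = ?W - edge_cut G Z" by (rule edge_cut_flip_component[OF ctx])
    \<comment> \<open>Vertices of \<open>Z\<close> have joins as short as \<open>F\<close>, which is
      shorter than \<open>m\<close>.\<close>
    have LZ: "x \<notin> Z" if "x \<in> L" for x
    proof
      assume x: "x \<in> Z"
      have "x \<in> verts G" using that assms(2) by auto
      then obtain I where "I \<subseteq> edges G" "odd_verts G I = U \<triangle> {x}" "card (I \<inter> ?W) = card (F \<inter> ?W)"
        by (rule component_join[OF ctx x])
      then show False using less.prems(2)[OF that, of I] False by simp
    qed
    have drop: "card (I \<inter> ?W') < card (I \<inter> ?W)"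
      if "I \<subseteq> edges G" "odd_verts G I = U \<triangle> Y" "Y \<inter> Z = {}" for I Y
    proof -
      have "I \<inter> edge_cut G Z \<noteq> {}" using odd_component_cut[OF ctx that] by auto
      then have "I \<inter> ?W' \<subset> I \<inter> ?W" using W' component_cut_subset[OF ctx] by blast
      then show ?thesis using finite_join[OF G that(1)] by (intro psubset_card_mono) auto
    qed
    have J: "card (J \<inter> ?W') < card (J \<inter> ?W)"
      using drop[OF assms(7,8)] LZ assms(4) by blast
    then have "?W' \<noteq> ?W" by auto
    then have "card ?W' < card ?W"
      using W' finite_join[OF G edge_cut_subset] by (intro psubset_card_mono) auto
    \<comment> \<open>On \<open>Z\<close> the old length is already below \<open>m\<close>;
      elsewhere an odd crossing saves at least 1. The subtraction \<open>m - 1\<close> does not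
      truncate, as \<open>m\<close> exceeds the length of \<open>F\<close>.\<close>
    moreover have "\<exists>I\<subseteq>edges G. odd_verts G I = U \<triangle> {x} \<and> card (I \<inter> ?W') \<le> m - 1"
      if x: "x \<in> verts G" for x
    proof (cases "x \<in> Z")
      case True
      obtain I where I: "I \<subseteq> edges G" "odd_verts G I = U \<triangle> {x}" "card (I \<inter> ?W) = card (F \<inter> ?W)"
        by (rule component_join[OF ctx True x])
      moreover have "card (I \<inter> ?W') \<le> card (I \<inter> ?W)"
        using finite_join[OF G I(1)] W' by (intro card_mono) auto
      ultimately show ?thesis using False by (intro exI[of _ I]) auto
    next
      case x_notin: False
      obtain I where I: "I \<subseteq> edges G" "odd_verts G I = U \<triangle> {x}" "card (I \<inter> ?W) \<le> m"
        using less.prems(1)[OF x] by auto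
      then show ?thesis using drop[OF I(1,2)] x_notin by (intro exI[of _ I]) auto
    qed
    moreover have "m - 1 \<le> card (I \<inter> ?W')"
      if I: "x \<in> L" "I \<subseteq> edges G" "odd_verts G I = U \<triangle> {x}" for x I
    proof -
      obtain I' where "I' \<subseteq> edges G" "odd_verts G I' = U \<triangle> {x}" "card (I' \<inter> ?W) \<le> card (I \<inter> ?W') + 1"
        using component_cut_reduce[OF ctx I(2,3) LZ[OF I(1)]] W' by auto
      then show ?thesis using less.prems(2)[OF I(1), of I'] by simp
    qed
    ultimately have "m - 1 \<le> card (J \<inter> ?W')" by (rule less.hyps)
    then show ?thesis using J by simp
  qed
qed

section \<open>Primal grafts\<close>

lemma card_symdiff_weight:
  assumes "finite F" "finite P"
  shows "int (card (F \<triangle> P)) = int (card F) + join_weight F P"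
proof -
  have "P \<inter> (F \<triangle> P) = P - F" by auto
  then show ?thesis
    using card_exchange[of F "F \<triangle> P" P UNIV] assms
    by (auto simp: join_weight_def symdiff_ac)
qed

text \<open>Otherwise the component of \<open>x\<close> would contain exactly one odd vertex of
  \<open>N\<close> while no edge of \<open>N\<close> leaves it, against cut parity.\<close>

lemma odd_verts_linked:
  assumes "is_mgraph G" "N \<subseteq> edges G" "odd_verts G N = {x} \<triangle> {y}"
  shows "(x, y) \<in> (adj G N)\<^sup>*"
proof -
  define K where "K = (adj G N)\<^sup>* `` {x}"
  have "e \<notin> edge_cut G K" if e: "e \<in> N" for e
  proof -
    have eE: "e \<in> edges G" using e assms(2) by auto
    obtain u v where uv: "ends G e = {u, v}" "u \<noteq> v" using edge_ends[OF assms(1) eE] by metis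
    have "(u, v) \<in> adj G N" "(v, u) \<in> adj G N"
      using e uv by (auto simp: adj_def insert_commute)
    then have "u \<in> K \<longleftrightarrow> v \<in> K"
      unfolding K_def by (auto intro: rtrancl_into_rtrancl)
    then show ?thesis using in_edge_cut[OF eE uv] by auto
  qed
  then have "N \<inter> edge_cut G K = {}" by auto
  then have "x \<in> K \<longleftrightarrow> y \<in> K"
    using cut_parity[OF assms(1,2), of K] odd_card_pair[of x y K] assms(3) by auto
  then show ?thesis by (simp add: K_def)
qed

lemma join_dist_nonpos:
  assumes "is_mgraph G" "F \<subseteq> edges G" "odd_verts G F = T" "join_dist G F r x \<le> 0"
  shows "\<exists>J\<subseteq>edges G. odd_verts G J = T \<triangle> {r} \<triangle> {x} \<and> card J \<le> card F"
proof (cases "r = x")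
  case True
  then show ?thesis using assms by (intro exI[of _ F]) (auto simp: symdiff_ac)
next
  case False
  have "\<exists>vs es. is_path G r vs es x \<and> join_weight F (set es) \<le> 0"
  proof (rule ccontr)
    assume "\<not> ?thesis"
    then have *: "1 \<le> join_weight F (set es)" if "is_path G r vs es x" for vs es
      using that by fastforce
    \<comment> \<open>Weights are integers, so if none is at most 0, their infimum is at least
      1.\<close>
    have "1 \<le> join_dist G F r x"
      using False * unfolding join_dist_def by (auto intro!: INF_greatest)
    then have "(1 :: ereal) \<le> 0" using assms(4) by (rule order_trans)
    then show False by simp
  qed
  then obtain vs es where p: "is_path G r vs es x" "join_weight F (set es) \<le> 0" by auto
  have "set es \<subseteq> edges G" using p(1) by (auto simp: is_path_def in_set_conv_nth)
  moreover have "finite F" using finite_join assms by blast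
  ultimately show ?thesis
    using p(2) is_path_odd_verts[OF p(1)] assms(2,3) card_symdiff_weight[of F "set es"]
    by (intro exI[of _ "F \<triangle> set es"]) (auto simp: symdiff_ac)
qed

text \<open>\<open>J \<triangle> F\<close> contains a path from \<open>r\<close> to
  \<open>x\<close>, of weight at least 0 with respect to \<open>F\<close>. Flipping it in
  \<open>J\<close> gives a join for \<open>T\<close> with at most \<open>card J\<close>
  edges.\<close>

lemma join_dist_nonneg:
  assumes "is_mgraph G" "F \<subseteq> edges G" "odd_verts G F = T"
    and min: "\<And>J. J \<subseteq> edges G \<Longrightarrow> odd_verts G J = T \<Longrightarrow> card F \<le> card J"
    and "join_dist G F r x \<ge> 0" "x \<in> verts G"
    and J: "J \<subseteq> edges G" "odd_verts G J = T \<triangle> {r} \<triangle> {x}"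
  shows "card F \<le> card J"
proof (cases "r = x")
  case True
  then show ?thesis using min[of J] J by (simp add: symdiff_ac)
next
  case False
  have fin: "finite F" "finite J" using finite_join assms by blast+
  have N: "J \<triangle> F \<subseteq> edges G" using assms by (intro symdiff_subset)
  have "odd_verts G (J \<triangle> F) = {r} \<triangle> {x}"
    using fin J assms(3) by (simp add: symdiff_ac)
  then have "(r, x) \<in> (adj G (J \<triangle> F))\<^sup>*" by (rule odd_verts_linked[OF assms(1) N])
  from is_path_exists[OF this assms(1) N assms(6)]
  obtain vs es where p: "is_path G r vs es x" "set es \<subseteq> J \<triangle> F" by auto
  let ?P = "set es"
  have "join_dist G F r x \<le> ereal (of_int (join_weight F ?P))"
    using False p(1) by (auto simp: join_dist_def intro!: INF_lower2[of "(vs, es)"])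
  then have "0 \<le> ereal (of_int (join_weight F ?P))" using assms(5) by (rule order_trans[rotated])
  then have "0 \<le> join_weight F ?P" by simp
  moreover have "?P - F = ?P \<inter> J" using p(2) by (auto simp: subset_iff)
  ultimately have w: "card (?P \<inter> F) \<le> card (?P \<inter> J)" by (simp add: join_weight_def)
  have "odd_verts G (J \<triangle> ?P) = T"
    using fin J is_path_odd_verts[OF p(1)] by (simp add: symdiff_ac)
  moreover have "J \<triangle> ?P \<subseteq> edges G" using J(1) N p(2) by (intro symdiff_subset) auto
  ultimately have "card F \<le> card (J \<triangle> ?P)" by (intro min)
  then show ?thesis
    using card_exchange[OF fin(2,1), of ?P UNIV] p(2) w by (simp add: symdiff_commute)
qed

context
  fixes G :: "('v, 'e) mgraph" and T F AG BG :: "_ set" and r :: 'v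
  assumes primal: "primal G T r" and bip: "bipartition G AG BG" and F: "minimum_join G T F"
begin

lemma primal_graft: "is_mgraph G" "T \<subseteq> verts G" "r \<in> verts G"
  using primal by (auto simp: primal_def is_graft_def)

private lemmas join_iff = is_join_iff[OF primal_graft(1,2)]

text \<open>Primality supplies a minimum join \<open>F'\<close>, possibly other than
  \<open>F\<close> but of the same size, in which a path of nonpositive weight to \<open>x\<close>
  can be flipped.\<close>

lemma primal_shifted_join:
  assumes "x \<in> verts G"
  shows "\<exists>J\<subseteq>edges G. odd_verts G J = T \<triangle> {r} \<triangle> {x} \<and> card J \<le> card F"
proof -
  obtain F' where F': "minimum_join G T F'" "join_dist G F' r x \<le> 0"
    using primal assms by (auto simp: primal_def)
  then have "card F' \<le> card F" using F by (auto simp: minimum_join_iff)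
  then show ?thesis
    using join_dist_nonpos[OF primal_graft(1), of F' T r x] F'
    by (auto simp: minimum_join_iff join_iff intro: order_trans)
qed

text \<open>The case \<open>U = T \<triangle> {r}\<close>, \<open>K = AG\<close> of
  \<open>level_bound\<close>: all edges cross between the colour classes, so lengths are
  cardinalities. Primality bounds the least sizes by \<open>card F\<close> from above everywhere,
  and distance 0 bounds them from below on the zero level.\<close>

lemma zero_level_bound:
  assumes "X \<subseteq> zero_level G T r" "J \<subseteq> edges G" "odd_verts G J = T \<triangle> {r} \<triangle> X"
  shows "card F \<le> card J"
proof -
  have cut: "edge_cut G AG = edges G"
  proof -
    have "e \<in> edge_cut G AG" if e: "e \<in> edges G" for e
    proof -
      obtain x y where xy: "ends G e = {x, y}" "x \<noteq> y" using edge_ends[OF primal_graft(1) e] by metis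
      have "{x, y} \<inter> AG \<noteq> {}" "{x, y} \<inter> BG \<noteq> {}" "AG \<inter> BG = {}"
        using bip e xy by (auto simp: bipartition_def)
      then show ?thesis using in_edge_cut[OF e xy] by auto
    qed
    then show ?thesis using edge_cut_subset[of G AG] by auto
  qed
  have meets: "I \<inter> edge_cut G AG = I" if "I \<subseteq> edges G" for I
    using that cut by auto
  have r: "r \<in> zero_level G T r"
    using F primal_graft(3) by (auto simp: zero_level_def join_dist_def)
  have "card F \<le> card (J \<inter> edge_cut G AG)"
  proof (rule level_bound[OF primal_graft(1) _ _ assms(1) _ _ assms(2,3)])
    show "zero_level G T r \<subseteq> verts G" by (auto simp: zero_level_def)
    show "zero_level G T r \<noteq> {}" using r by auto
    show "\<exists>J\<subseteq>edges G. odd_verts G J = T \<triangle> {r} \<triangle> {x} \<and> card (J \<inter> edge_cut G AG) \<le> card F"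
      if x: "x \<in> verts G" for x
    proof -
      obtain I where "I \<subseteq> edges G" "odd_verts G I = T \<triangle> {r} \<triangle> {x}" "card I \<le> card F"
        using primal_shifted_join[OF x] by auto
      then show ?thesis using meets by (intro exI[of _ I]) simp
    qed
    show "card F \<le> card (J \<inter> edge_cut G AG)"
      if x: "x \<in> zero_level G T r" and J: "J \<subseteq> edges G" "odd_verts G J = T \<triangle> {r} \<triangle> {x}" for x J
    proof -
      obtain F' where F': "minimum_join G T F'" "join_dist G F' r x = 0" "x \<in> verts G"
        using x by (auto simp: zero_level_def)
      have "card F \<le> card F'" using F F' by (auto simp: minimum_join_iff)
      also have "card F' \<le> card J"
        by (rule join_dist_nonneg[OF primal_graft(1), of F' T r x])
          (use F' J in \<open>auto simp: minimum_join_iff join_iff\<close>)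
      finally show ?thesis using meets[OF J(1)] by simp
    qed
  qed
  then show ?thesis using meets[OF assms(2)] by simp
qed

end

section \<open>Syntheses\<close>

locale synthesis_setup =
  fixes G Gh :: "('v, 'e) mgraph" and T Th A B :: "'v set"
    and H :: "'v \<Rightarrow> ('v, 'e) mgraph" and S AH BH :: "'v \<Rightarrow> 'v set" and r :: "'v \<Rightarrow> 'v"
  assumes comb: "comb G T A B"
    and tooth: "\<And>v. v \<in> B \<Longrightarrow> is_graft (H v) (S v) \<and> bipartition (H v) (AH v) (BH v) \<and>
           r v \<in> AH v \<and> primal (H v) (S v) (r v)"
    and disjoint: "disjoint_family_on (\<lambda>v. verts (H v)) B"
    and fresh: "\<And>v. v \<in> B \<Longrightarrow> verts (H v) \<inter> verts G = {}"
    and synth: "synthesis Gh Th G T A B H S r"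
begin

abbreviation cut :: "'v \<Rightarrow> 'e set" where
  "cut v \<equiv> edge_cut Gh (verts (H v))"

section \<open>Structure of the synthesis\<close>

lemma mgraphs: "is_mgraph G" "is_mgraph Gh" "v \<in> B \<Longrightarrow> is_mgraph (H v)"
  and terminals: "T \<subseteq> verts G" "Th \<subseteq> verts Gh" "v \<in> B \<Longrightarrow> S v \<subseteq> verts (H v)"
  using comb tooth synth by (auto simp: comb_def synthesis_def is_graft_def)

lemma root: "v \<in> B \<Longrightarrow> r v \<in> verts (H v)"
  using tooth by (auto simp: primal_def)

lemma finite_B: "finite B"
proof -
  have "finite (verts G)" "B \<subseteq> verts G"
    using comb mgraphs(1) by (auto simp: comb_def bipartition_def is_mgraph_def)
  then show ?thesis by (metis finite_subset)
qed

lemma tooth_subgraph: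
  assumes "v \<in> B"
  shows "edges (H v) \<subseteq> edges Gh" "verts (H v) \<subseteq> verts Gh"
    "edges_inside Gh (verts (H v)) = edges (H v)" "Th \<inter> verts (H v) = S v \<triangle> {r v}"
    "cut v = edges_between Gh A (zero_level (H v) (S v) (r v))"
    and "\<And>e. e \<in> edges (H v) \<Longrightarrow> ends (H v) e = ends Gh e"
    and "\<And>e. e \<in> edges (H v) \<Longrightarrow> ends Gh e \<subseteq> verts (H v)"
proof -
  have sub: "subgraph (H v) Gh" and ins: "edges_inside Gh (verts (H v)) = edges (H v)"
    and t: "Th \<inter> verts (H v) = sym_diff (S v) {r v}"
    and c: "cut v = edges_between Gh A (zero_level (H v) (S v) (r v))"
    using synth assms unfolding synthesis_def by blast+
  show "edges (H v) \<subseteq> edges Gh" "verts (H v) \<subseteq> verts Gh"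
    "\<And>e. e \<in> edges (H v) \<Longrightarrow> ends (H v) e = ends Gh e"
    using sub unfolding subgraph_def by blast+
  show "\<And>e. e \<in> edges (H v) \<Longrightarrow> ends Gh e \<subseteq> verts (H v)"
    using ins unfolding edges_inside_def by blast
  show "edges_inside Gh (verts (H v)) = edges (H v)" by (rule ins)
  show "Th \<inter> verts (H v) = S v \<triangle> {r v}" unfolding symdiff_def by (rule t)
  show "cut v = edges_between Gh A (zero_level (H v) (S v) (r v))" by (rule c)
qed

lemma skeleton:
  "B \<inter> verts Gh = {}"
  "edges G = edges Gh - (\<Union>v\<in>B. edges (H v))"
  "A = verts Gh - (\<Union>v\<in>B. verts (H v))"
  "A \<inter> B = {}" "A \<union> B = verts G"
  "\<And>e. e \<in> edges G \<Longrightarrow>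
     ends G e = (ends Gh e - (\<Union>v\<in>B. verts (H v))) \<union> {v \<in> B. ends Gh e \<inter> verts (H v) \<noteq> {}}"
  "T = (Th - (\<Union>v\<in>B. verts (H v))) \<union> {v \<in> B. odd (card (verts (H v) \<inter> Th))}"
proof -
  have same: "same_graph (contract Gh B (\<lambda>v. verts (H v))) G"
    and BV: "B \<inter> verts Gh = {}"
    and ct: "contract_terminals Th B (\<lambda>v. verts (H v)) = T"
    using synth unfolding synthesis_def by blast+
  have AB: "A \<union> B = verts G" "A \<inter> B = {}"
    using comb by (simp_all add: comb_def bipartition_def)
  have V: "(verts Gh - (\<Union>v\<in>B. verts (H v))) \<union> B = verts G"
    using same by (simp add: same_graph_def contract_def)
  have "edges G = edges Gh - (\<Union>v\<in>B. edges_inside Gh (verts (H v)))"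
    using same by (simp add: same_graph_def contract_def)
  then show "edges G = edges Gh - (\<Union>v\<in>B. edges (H v))"
    using tooth_subgraph(3) by simp
  show "A = verts Gh - (\<Union>v\<in>B. verts (H v))"
    using V AB BV by blast
  show "B \<inter> verts Gh = {}" "A \<inter> B = {}" "A \<union> B = verts G" by fact+
  show "T = (Th - (\<Union>v\<in>B. verts (H v))) \<union> {v \<in> B. odd (card (verts (H v) \<inter> Th))}"
    using ct by (simp add: contract_terminals_def)
  show "ends G e = (ends Gh e - (\<Union>v\<in>B. verts (H v))) \<union> {v \<in> B. ends Gh e \<inter> verts (H v) \<noteq> {}}"
    if "e \<in> edges G" for e
    using same that by (auto simp: same_graph_def contract_def)
qed

lemma ends_Gh: "e \<in> edges Gh \<Longrightarrow> card (ends Gh e) = 2 \<and> ends Gh e \<subseteq> verts Gh"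
  using mgraphs(2) by (simp add: is_mgraph_def)

lemma teeth_disjoint: "v \<in> B \<Longrightarrow> w \<in> B \<Longrightarrow> v \<noteq> w \<Longrightarrow> verts (H v) \<inter> verts (H w) = {}"
  using disjoint by (simp add: disjoint_family_on_def)

lemma tooth_edges_disjoint:
  assumes "v \<in> B" "w \<in> B" "v \<noteq> w"
  shows "edges (H v) \<inter> edges (H w) = {}"
proof (rule ccontr)
  assume "edges (H v) \<inter> edges (H w) \<noteq> {}"
  then obtain e where e: "e \<in> edges (H v)" "e \<in> edges (H w)" by auto
  then have "ends Gh e \<subseteq> verts (H v) \<inter> verts (H w)"
    using tooth_subgraph(7) assms by blast
  then have "ends Gh e = {}" using teeth_disjoint[OF assms] by auto
  then show False using ends_Gh[of e] e tooth_subgraph(1) assms by auto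
qed

text \<open>An edge of the skeleton does not lie inside the tooth, so if it meets the tooth, it does
  so in exactly one end.\<close>

lemma skeleton_edge_at_tooth:
  assumes "v \<in> B" "e \<in> edges G"
  shows "v \<in> ends G e \<longleftrightarrow> e \<in> cut v"
proof -
  have eh: "e \<in> edges Gh" "e \<notin> edges (H v)" using assms skeleton(2) by auto
  have "v \<notin> ends Gh e" using ends_Gh[OF eh(1)] skeleton(1) assms(1) by auto
  then have "v \<in> ends G e \<longleftrightarrow> ends Gh e \<inter> verts (H v) \<noteq> {}"
    using skeleton(6)[OF assms(2)] assms(1) by simp
  moreover obtain x y where xy: "ends Gh e = {x, y}" "x \<noteq> y" using edge_ends[OF mgraphs(2) eh(1)] by metis
  moreover have "\<not> ends Gh e \<subseteq> verts (H v)"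
    using eh tooth_subgraph(3)[OF assms(1)] by (auto simp: edges_inside_def)
  ultimately show ?thesis
    using in_edge_cut[OF eh(1) xy] by auto
qed

lemma cut_subset:
  assumes "v \<in> B"
  shows "cut v \<subseteq> edges G"
proof
  fix e assume e: "e \<in> cut v"
  then have eh: "e \<in> edges Gh" "card (ends Gh e \<inter> verts (H v)) = 1" by (auto simp: edge_cut_def)
  have "e \<notin> edges (H w)" if w: "w \<in> B" for w
  proof
    assume "e \<in> edges (H w)"
    then have sub: "ends Gh e \<subseteq> verts (H w)" using tooth_subgraph(7) w by blast
    show False
    proof (cases "w = v")
      case True
      then have "ends Gh e \<inter> verts (H v) = ends Gh e" using sub by auto
      then show False using eh ends_Gh[of e] by simp
    next
      case False
      then have "ends Gh e \<inter> verts (H v) = {}" using sub teeth_disjoint[OF w assms] by auto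
      then show False using eh by simp
    qed
  qed
  then show "e \<in> edges G" using eh skeleton(2) by auto
qed

lemma skeleton_cut:
  assumes "v \<in> B"
  shows "edge_cut G {v} = cut v"
proof (rule set_eqI)
  fix e
  show "e \<in> edge_cut G {v} \<longleftrightarrow> e \<in> cut v"
  proof (cases "e \<in> edges G")
    case True
    have "card (ends G e \<inter> {v}) = 1 \<longleftrightarrow> v \<in> ends G e"
      by (cases "v \<in> ends G e") auto
    then show ?thesis using True skeleton_edge_at_tooth[OF assms True] by (simp add: edge_cut_def)
  next
    case False
    then show ?thesis using cut_subset[OF assms] by (auto simp: edge_cut_def)
  qed
qed

text \<open>Condition (3) of a synthesis: the spine end lies outside all teeth, and the other end is
  at distance 0 from the root.\<close>

lemma cut_end:
  assumes "v \<in> B" "e \<in> cut v"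
  obtains z where "ends Gh e \<inter> verts (H v) = {z}" "z \<in> zero_level (H v) (S v) (r v)"
proof -
  obtain a z where az: "a \<in> A" "z \<in> zero_level (H v) (S v) (r v)" "ends Gh e = {a, z}"
    using assms tooth_subgraph(5) by (auto simp: edges_between_def)
  have "a \<notin> verts (H v)" using az(1) skeleton(3) assms(1) by auto
  moreover have "z \<in> verts (H v)" using az(2) by (auto simp: zero_level_def)
  ultimately have "ends Gh e \<inter> verts (H v) = {z}" using az(3) by auto
  then show ?thesis using that az(2) by blast
qed

section \<open>Restricting edge sets of the synthesis to the skeleton and the teeth\<close>

lemma odd_verts_skeleton_spine:
  assumes "M \<subseteq> edges Gh" "x \<in> A"
  shows "x \<in> odd_verts G (M \<inter> edges G) \<longleftrightarrow> x \<in> odd_verts Gh M"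
proof -
  have x: "x \<notin> B" "\<And>v. v \<in> B \<Longrightarrow> x \<notin> verts (H v)"
    using assms(2) skeleton(3,4) by auto
  have "e \<in> M \<inter> edges G \<and> x \<in> ends G e \<longleftrightarrow> e \<in> M \<and> x \<in> ends Gh e" for e
  proof (cases "e \<in> edges G")
    case True
    then show ?thesis using skeleton(6)[OF True] x by auto
  next
    case False
    have "x \<notin> ends Gh e" if e: "e \<in> M"
    proof -
      obtain v where "v \<in> B" "e \<in> edges (H v)" using e False assms(1) skeleton(2) by blast
      then show ?thesis using tooth_subgraph(7) x(2) by blast
    qed
    then show ?thesis using False by auto
  qed
  then show ?thesis by (simp add: odd_verts_def)
qed

lemma odd_verts_skeleton_tooth:
  assumes "M \<subseteq> edges Gh" "v \<in> B"
  shows "v \<in> odd_verts G (M \<inter> edges G) \<longleftrightarrow> odd (card (verts (H v) \<inter> odd_verts Gh M))"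
proof -
  have "{e \<in> M \<inter> edges G. v \<in> ends G e} = M \<inter> cut v"
    using skeleton_edge_at_tooth[OF assms(2)] cut_subset[OF assms(2)] by auto
  then show ?thesis
    using cut_parity[OF mgraphs(2) assms(1), of "verts (H v)"]
    by (simp add: odd_verts_def Int_commute)
qed

text \<open>An edge of \<open>M\<close> with an end in the tooth lies inside the tooth or in its
  cut; the remaining edges, called \<open>N\<close> in the proof, contribute nothing there.\<close>

lemma odd_verts_tooth:
  assumes "M \<subseteq> edges Gh" "v \<in> B"
  shows "odd_verts (H v) (M \<inter> edges (H v)) =
    (odd_verts Gh M \<inter> verts (H v)) \<triangle> (odd_verts Gh (M \<inter> cut v) \<inter> verts (H v))"
proof -
  let ?E = "edges (H v)"
  have fin: "finite M" using finite_join[OF mgraphs(2) assms(1)] .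
  have E: "odd_verts (H v) (M \<inter> ?E) = odd_verts Gh (M \<inter> ?E)"
  proof -
    have "{e \<in> M \<inter> ?E. x \<in> ends (H v) e} = {e \<in> M \<inter> ?E. x \<in> ends Gh e}" for x
      using tooth_subgraph(6)[OF assms(2)] by auto
    then show ?thesis by (simp add: odd_verts_def)
  qed
  have sub: "odd_verts (H v) (M \<inter> ?E) \<subseteq> verts (H v)"
    by (rule odd_verts_subset_verts[OF mgraphs(3)[OF assms(2)]]) simp
  define N where "N = M - ?E - cut v"
  have "odd_verts Gh N \<inter> verts (H v) = {}"
  proof -
    have "x \<notin> ends Gh e" if e: "e \<in> N" and x: "x \<in> verts (H v)" for e x
    proof
      assume "x \<in> ends Gh e"
      have eh: "e \<in> edges Gh" "e \<notin> ?E" "e \<notin> cut v" using e assms(1) by (auto simp: N_def)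
      obtain a b where ab: "ends Gh e = {a, b}" "a \<noteq> b" using edge_ends[OF mgraphs(2) eh(1)] by metis
      have "ends Gh e \<subseteq> verts (H v)"
        using in_edge_cut[OF eh(1) ab] eh(3) \<open>x \<in> ends Gh e\<close> x ab(1) by auto
      then show False using eh tooth_subgraph(3)[OF assms(2)] by (auto simp: edges_inside_def)
    qed
    then have "{e \<in> N. x \<in> ends Gh e} = {}" if "x \<in> verts (H v)" for x using that by blast
    then have "x \<notin> odd_verts Gh N" if "x \<in> verts (H v)" for x
      using that by (simp add: odd_verts_def del: Collect_empty_eq)
    then show ?thesis by blast
  qed
  moreover have "?E \<inter> cut v = {}"
    using cut_subset[OF assms(2)] skeleton(2) assms(2) by auto
  then have "M = (M \<inter> ?E) \<triangle> (M \<inter> cut v) \<triangle> N"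
    unfolding N_def by (auto simp: set_eq_iff)
  then have "odd_verts Gh M = odd_verts Gh (M \<inter> ?E) \<triangle> odd_verts Gh (M \<inter> cut v) \<triangle> odd_verts Gh N"
    using fin by (metis N_def finite_Diff finite_Int finite_symdiff odd_verts_symdiff)
  ultimately show ?thesis
    using sub unfolding E by (auto simp: set_eq_iff)
qed

lemma cut_ends_zero_level:
  assumes "v \<in> B"
  shows "odd_verts Gh (M \<inter> cut v) \<inter> verts (H v) \<subseteq> zero_level (H v) (S v) (r v)"
proof
  fix x assume x: "x \<in> odd_verts Gh (M \<inter> cut v) \<inter> verts (H v)"
  then have "{e \<in> M \<inter> cut v. x \<in> ends Gh e} \<noteq> {}"
    by (auto simp: odd_verts_def simp del: Collect_empty_eq)
  then obtain e where e: "e \<in> cut v" "x \<in> ends Gh e" by auto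
  obtain z where z: "ends Gh e \<inter> verts (H v) = {z}" "z \<in> zero_level (H v) (S v) (r v)"
    by (rule cut_end[OF assms e(1)])
  have "x \<in> ends Gh e \<inter> verts (H v)" using x e by simp
  then show "x \<in> zero_level (H v) (S v) (r v)" using z by simp
qed

lemma skeleton_join:
  assumes "is_join Gh Th M"
  shows "is_join G T (M \<inter> edges G)"
proof -
  have M: "M \<subseteq> edges Gh" "odd_verts Gh M = Th"
    using assms is_join_iff[OF mgraphs(2) terminals(2)] by auto
  have "x \<in> odd_verts G (M \<inter> edges G) \<longleftrightarrow> x \<in> T" if "x \<in> verts G" for x
  proof (cases "x \<in> B")
    case True
    then have "x \<notin> Th" using skeleton(1) terminals(2) by auto
    then show ?thesis using odd_verts_skeleton_tooth[OF M(1) True] M(2) skeleton(7) True by simp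
  next
    case False
    then have "x \<in> A" using that skeleton(5) by auto
    then show ?thesis
      using odd_verts_skeleton_spine[OF M(1)] M(2) skeleton(7,3) False by auto
  qed
  then have "odd_verts G (M \<inter> edges G) = T"
    using odd_verts_subset_verts[OF mgraphs(1), of "M \<inter> edges G"] terminals(1) by auto
  then show ?thesis using is_join_iff[OF mgraphs(1) terminals(1)] by simp
qed

section \<open>Sizes of joins in the teeth\<close>

definition tooth_join :: "'v \<Rightarrow> 'e set" where
  "tooth_join v = (SOME F. minimum_join (H v) (S v) F)"

lemma tooth_join:
  assumes "v \<in> B"
  shows "minimum_join (H v) (S v) (tooth_join v)"
proof -
  obtain F where "minimum_join (H v) (S v) F"
    using tooth[OF assms] unfolding primal_def by blast
  then show ?thesis unfolding tooth_join_def by (rule someI)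
qed

lemma tooth_bound:
  assumes "v \<in> B" "X \<subseteq> zero_level (H v) (S v) (r v)" "J \<subseteq> edges (H v)"
    "odd_verts (H v) J = S v \<triangle> {r v} \<triangle> X"
  shows "card (tooth_join v) \<le> card J"
  using zero_level_bound[OF _ _ tooth_join[OF assms(1)] assms(2-4)] tooth[OF assms(1)] by blast

text \<open>\<open>tooth_bound\<close> for \<open>{x}\<close> and the shifted joins supplied by
  primality fix the minimum size as that of \<open>tooth_join v\<close>. Minimality thereby becomes
  a condition on cardinality.\<close>

lemma shifted_minimum_join_iff:
  assumes "v \<in> B" "x \<in> zero_level (H v) (S v) (r v)"
  shows "minimum_join (H v) (sym_diff (sym_diff (S v) {r v}) {x}) J \<longleftrightarrow>
    J \<subseteq> edges (H v) \<and> odd_verts (H v) J = S v \<triangle> {r v} \<triangle> {x} \<and> card J = card (tooth_join v)"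
    (is "minimum_join _ ?S J \<longleftrightarrow> _")
proof -
  have x: "x \<in> verts (H v)" using assms(2) by (simp add: zero_level_def)
  have S: "?S = S v \<triangle> {r v} \<triangle> {x}" by (simp add: symdiff_def)
  have sub: "?S \<subseteq> verts (H v)" using terminals(3) root x assms(1) by auto
  have jn: "is_join (H v) ?S I \<longleftrightarrow> I \<subseteq> edges (H v) \<and> odd_verts (H v) I = S v \<triangle> {r v} \<triangle> {x}" for I
    using is_join_iff[OF mgraphs(3)[OF assms(1)] sub, of I] unfolding S .
  have lower: "card (tooth_join v) \<le> card I" if "is_join (H v) ?S I" for I
    using tooth_bound[OF assms(1), of "{x}" I] assms(2) that jn by simp
  obtain I where I: "is_join (H v) ?S I" "card I \<le> card (tooth_join v)"
    using primal_shifted_join[OF _ _ tooth_join[OF assms(1)] x] tooth[OF assms(1)] jn by blast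
  have "minimum_join (H v) ?S J \<longleftrightarrow> is_join (H v) ?S J \<and> card J = card (tooth_join v)"
  proof
    assume "minimum_join (H v) ?S J"
    then have "is_join (H v) ?S J" "card J \<le> card I" using I(1) by (simp_all add: minimum_join_iff)
    then show "is_join (H v) ?S J \<and> card J = card (tooth_join v)" using I(2) lower[of J] by simp
  qed (use lower in \<open>simp add: minimum_join_iff\<close>)
  then show ?thesis using jn by blast
qed

lemma card_decomposition:
  assumes "M \<subseteq> edges Gh"
  shows "card M = card (M \<inter> edges G) + (\<Sum>v\<in>B. card (M \<inter> edges (H v)))"
proof -
  have fin: "finite M" using finite_join[OF mgraphs(2) assms] .
  have "M = (M \<inter> edges G) \<union> (\<Union>v\<in>B. M \<inter> edges (H v))"
    using assms skeleton(2) by auto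
  moreover have "card ((M \<inter> edges G) \<union> (\<Union>v\<in>B. M \<inter> edges (H v))) =
      card (M \<inter> edges G) + card (\<Union>v\<in>B. M \<inter> edges (H v))"
    using fin finite_B skeleton(2) by (intro card_Un_disjoint) auto
  moreover have "card (\<Union>v\<in>B. M \<inter> edges (H v)) = (\<Sum>v\<in>B. card (M \<inter> edges (H v)))"
    using fin finite_B tooth_edges_disjoint by (intro card_UN_disjoint) auto
  ultimately show ?thesis by metis
qed

text \<open>The terminals of the restriction are shifted at the tooth ends of an odd number of cut
  edges of \<open>M\<close>. There may be any number of these ends, which is why the estimate is
  proved for sets \<open>X\<close> and not only for single vertices.\<close>

lemma tooth_restriction:
  assumes "is_join Gh Th M" "v \<in> B"
  shows "odd_verts (H v) (M \<inter> edges (H v)) =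
      S v \<triangle> {r v} \<triangle> (odd_verts Gh (M \<inter> cut v) \<inter> verts (H v))"
    and "card (tooth_join v) \<le> card (M \<inter> edges (H v))"
proof -
  have M: "M \<subseteq> edges Gh" "odd_verts Gh M = Th"
    using assms is_join_iff[OF mgraphs(2) terminals(2)] by auto
  show eq: "odd_verts (H v) (M \<inter> edges (H v)) =
      S v \<triangle> {r v} \<triangle> (odd_verts Gh (M \<inter> cut v) \<inter> verts (H v))"
    using odd_verts_tooth[OF M(1) assms(2)] M(2) tooth_subgraph(4)[OF assms(2)] by simp
  show "card (tooth_join v) \<le> card (M \<inter> edges (H v))"
    using tooth_bound[OF assms(2) cut_ends_zero_level[OF assms(2)] _ eq] by simp
qed

section \<open>Gluing and splitting minimum joins\<close>

abbreviation compatible :: "'e set \<Rightarrow> ('v \<Rightarrow> 'e set) \<Rightarrow> bool" where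
  "compatible F Fv \<equiv> (\<forall>v\<in>B. \<exists>e r'. edge_cut G {v} \<inter> F = {e} \<and> ends Gh e \<inter> verts (H v) = {r'} \<and>
     minimum_join (H v) (sym_diff (sym_diff (S v) {r v}) {r'}) (Fv v))"

text \<open>The unique edge of \<open>F\<close> at a tooth changes the parity at its end
  \<open>r'\<close>, and the shift of the terminals of \<open>Fv v\<close> at \<open>r'\<close>
  compensates for this.\<close>

lemma compatible_join:
  assumes F: "minimum_join G T F" and "compatible F Fv"
  shows "is_join Gh Th (F \<union> (\<Union>v\<in>B. Fv v))"
    and "card (F \<union> (\<Union>v\<in>B. Fv v)) = card F + (\<Sum>v\<in>B. card (tooth_join v))"
proof -
  define M where "M = F \<union> (\<Union>v\<in>B. Fv v)"
  have FG: "F \<subseteq> edges G" "odd_verts G F = T"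
    using F by (auto simp: minimum_join_iff is_join_iff[OF mgraphs(1) terminals(1)])
  have Fv: "Fv v \<subseteq> edges (H v) \<and> card (Fv v) = card (tooth_join v) \<and>
      odd_verts (H v) (Fv v) = S v \<triangle> {r v} \<triangle> (odd_verts Gh (F \<inter> cut v) \<inter> verts (H v))"
    if v: "v \<in> B" for v
  proof -
    obtain e x where e: "edge_cut G {v} \<inter> F = {e}" and x: "ends Gh e \<inter> verts (H v) = {x}"
      and m: "minimum_join (H v) (sym_diff (sym_diff (S v) {r v}) {x}) (Fv v)"
      using assms(2) v by blast
    have ec: "F \<inter> cut v = {e}" using e skeleton_cut[OF v] by auto
    then have "e \<in> cut v" by auto
    then obtain z where z: "ends Gh e \<inter> verts (H v) = {z}" "z \<in> zero_level (H v) (S v) (r v)"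
      by (rule cut_end[OF v])
    then have "z = x" using x by auto
    then show ?thesis
      using shifted_minimum_join_iff[OF v, of x "Fv v"] m z x ec by simp
  qed
  have "Fv v \<inter> edges G = {}" if "v \<in> B" for v
    using Fv[OF that] skeleton(2) that by auto
  then have MG: "M \<inter> edges G = F"
    unfolding M_def using FG(1) by blast
  have MH: "M \<inter> edges (H v) = Fv v" if v: "v \<in> B" for v
  proof -
    have "Fv w \<inter> edges (H v) = {}" if "w \<in> B" "w \<noteq> v" for w
      using tooth_edges_disjoint[OF that(1) v that(2)] Fv[OF that(1)] by auto
    moreover have "F \<inter> edges (H v) = {}" using FG(1) skeleton(2) v by auto
    ultimately show ?thesis unfolding M_def using Fv[OF v] v by blast
  qed
  have Mh: "M \<subseteq> edges Gh"
    unfolding M_def using FG(1) skeleton(2) Fv tooth_subgraph(1) by blast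
  have Mcut: "M \<inter> cut v = F \<inter> cut v" if "v \<in> B" for v
    using cut_subset[OF that] MG by auto
  \<comment> \<open>The contribution of the cut occurs both in \<open>odd_verts_tooth\<close> and in
    the boundary of \<open>Fv v\<close>; cancelling it leaves
    \<open>S v \<triangle> {r v}\<close>.\<close>
  have "odd_verts Gh M \<inter> verts (H v) = Th \<inter> verts (H v)" if v: "v \<in> B" for v
    using odd_verts_tooth[OF Mh v] Fv[OF v] MH[OF v] Mcut[OF v] tooth_subgraph(4)[OF v]
    by (metis symdiff_left_self symdiff_commute)
  moreover have "x \<in> odd_verts Gh M \<longleftrightarrow> x \<in> Th" if x: "x \<in> A" for x
    using odd_verts_skeleton_spine[OF Mh x] MG FG(2) skeleton(3,4,7) x by auto
  moreover have "verts Gh \<subseteq> A \<union> (\<Union>v\<in>B. verts (H v))" using skeleton(3) by auto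
  ultimately have "x \<in> odd_verts Gh M \<longleftrightarrow> x \<in> Th" if "x \<in> verts Gh" for x
    using that by blast
  then have "odd_verts Gh M = Th"
    using odd_verts_subset_verts[OF mgraphs(2) Mh] terminals(2) by auto
  then show "is_join Gh Th (F \<union> (\<Union>v\<in>B. Fv v))"
    using Mh is_join_iff[OF mgraphs(2) terminals(2)] by (simp add: M_def)
  show "card (F \<union> (\<Union>v\<in>B. Fv v)) = card F + (\<Sum>v\<in>B. card (tooth_join v))"
    using card_decomposition[OF Mh] MG MH Fv unfolding M_def by simp
qed

lemma skeleton_cut_edge:
  assumes "minimum_join G T F" "v \<in> B"
  obtains e z where "edge_cut G {v} \<inter> F = {e}" "ends Gh e \<inter> verts (H v) = {z}"
    "z \<in> zero_level (H v) (S v) (r v)"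
proof -
  have "card (edge_cut G {v} \<inter> F) = 1" using comb assms by (simp add: comb_def)
  then obtain e where e: "edge_cut G {v} \<inter> F = {e}" by (auto simp: card_1_singleton_iff)
  then have "e \<in> cut v" using skeleton_cut[OF assms(2)] by auto
  then show ?thesis using cut_end[OF assms(2)] that e by metis
qed

lemma compatible_exists:
  assumes F: "minimum_join G T F"
  shows "\<exists>Fv. compatible F Fv"
proof -
  have "\<exists>I. \<exists>e r'. edge_cut G {v} \<inter> F = {e} \<and> ends Gh e \<inter> verts (H v) = {r'} \<and>
     minimum_join (H v) (sym_diff (sym_diff (S v) {r v}) {r'}) I" if v: "v \<in> B" for v
  proof -
    obtain e z where ez: "edge_cut G {v} \<inter> F = {e}" "ends Gh e \<inter> verts (H v) = {z}"
      "z \<in> zero_level (H v) (S v) (r v)"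
      by (rule skeleton_cut_edge[OF F v])
    have z: "z \<in> verts (H v)" using ez(2) by auto
    have sub: "sym_diff (sym_diff (S v) {r v}) {z} \<subseteq> verts (H v)"
      using terminals(3) root z v by auto
    obtain I where "I \<subseteq> edges (H v)" "odd_verts (H v) I = S v \<triangle> {r v} \<triangle> {z}"
      using primal_shifted_join[OF _ _ tooth_join[OF v] z] tooth[OF v] by blast
    then have "is_join (H v) (sym_diff (sym_diff (S v) {r v}) {z}) I"
      unfolding is_join_iff[OF mgraphs(3)[OF v] sub] by (simp add: symdiff_def)
    then obtain I' where "minimum_join (H v) (sym_diff (sym_diff (S v) {r v}) {z}) I'"
      by (rule minimum_join_exists)
    then show ?thesis using ez by blast
  qed
  then show ?thesis by metis
qed

text \<open>The parts of \<open>M\<close> are bounded separately: its skeleton part is a join of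
  \<open>G\<close>, and each tooth part obeys \<open>tooth_restriction\<close>.\<close>

lemma join_bound:
  assumes "minimum_join G T F" "is_join Gh Th M"
  shows "card F + (\<Sum>v\<in>B. card (tooth_join v)) \<le> card M"
proof -
  have "M \<subseteq> edges Gh" using assms(2) by (simp add: is_join_def)
  moreover have "card F \<le> card (M \<inter> edges G)"
    using assms skeleton_join by (auto simp: minimum_join_iff)
  moreover have "(\<Sum>v\<in>B. card (tooth_join v)) \<le> (\<Sum>v\<in>B. card (M \<inter> edges (H v)))"
    by (intro sum_mono tooth_restriction(2) assms)
  ultimately show ?thesis using card_decomposition by simp
qed

lemma compatible_minimum:
  assumes "minimum_join G T F" "compatible F Fv"
  shows "minimum_join Gh Th (F \<union> (\<Union>v\<in>B. Fv v))"
  using compatible_join[OF assms] join_bound[OF assms(1)] by (simp add: minimum_join_iff)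

text \<open>Some glued join attains the sum of the separate lower bounds, so for a minimum join
  \<open>M\<close> each of these bounds is an equality.\<close>

lemma minimum_join_restricts:
  assumes M: "minimum_join Gh Th M"
  shows "minimum_join G T (M \<inter> edges G)"
    and "compatible (M \<inter> edges G) (\<lambda>v. M \<inter> edges (H v))"
    and "M = (M \<inter> edges G) \<union> (\<Union>v\<in>B. M \<inter> edges (H v))"
proof -
  have MJ: "is_join Gh Th M" and Mh: "M \<subseteq> edges Gh"
    using M by (auto simp: minimum_join_iff is_join_def)
  show "M = (M \<inter> edges G) \<union> (\<Union>v\<in>B. M \<inter> edges (H v))"
    using Mh skeleton(2) by auto
  obtain F where F: "minimum_join G T F"
    using skeleton_join[OF MJ] by (rule minimum_join_exists)
  obtain Fv where Fv: "compatible F Fv" using compatible_exists[OF F] by auto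
  have le: "card M \<le> card F + (\<Sum>v\<in>B. card (tooth_join v))"
    using M compatible_join[OF F Fv] by (auto simp: minimum_join_iff)
  have F_le: "card F \<le> card (M \<inter> edges G)"
    using F skeleton_join[OF MJ] by (simp add: minimum_join_iff)
  have sums: "(\<Sum>v\<in>B. card (tooth_join v)) \<le> (\<Sum>v\<in>B. card (M \<inter> edges (H v)))"
    by (intro sum_mono tooth_restriction(2) MJ)
  have "card (M \<inter> edges G) = card F"
    and sum_eq: "(\<Sum>v\<in>B. card (tooth_join v)) = (\<Sum>v\<in>B. card (M \<inter> edges (H v)))"
    using le F_le sums card_decomposition[OF Mh] by linarith+
  then show min: "minimum_join G T (M \<inter> edges G)"
    using F skeleton_join[OF MJ] by (simp add: minimum_join_iff)
  have card_eq: "card (tooth_join v) = card (M \<inter> edges (H v))" if "v \<in> B" for v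
    using sum_mono_inv[OF sum_eq tooth_restriction(2)[OF MJ] that finite_B] .
  show "compatible (M \<inter> edges G) (\<lambda>v. M \<inter> edges (H v))"
  proof
    fix v assume v: "v \<in> B"
    obtain e z where ez: "edge_cut G {v} \<inter> (M \<inter> edges G) = {e}" "ends Gh e \<inter> verts (H v) = {z}"
      "z \<in> zero_level (H v) (S v) (r v)"
      by (rule skeleton_cut_edge[OF min v])
    \<comment> \<open>The skeleton part of \<open>M\<close> is now known to be a minimum join of the
      comb, so \<open>M\<close> crosses the cut once and the shift set in
      \<open>tooth_restriction\<close> is \<open>{z}\<close>.\<close>
    have "M \<inter> cut v = {e}" using ez(1) skeleton_cut[OF v] cut_subset[OF v] by auto
    then have "minimum_join (H v) (sym_diff (sym_diff (S v) {r v}) {z}) (M \<inter> edges (H v))"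
      using tooth_restriction(1)[OF MJ v] card_eq[OF v] ez
      by (simp add: shifted_minimum_join_iff[OF v ez(3)])
    then show "\<exists>e r'. edge_cut G {v} \<inter> (M \<inter> edges G) = {e} \<and> ends Gh e \<inter> verts (H v) = {r'} \<and>
      minimum_join (H v) (sym_diff (sym_diff (S v) {r v}) {r'}) (M \<inter> edges (H v))"
      using ez by blast
  qed
qed

lemma minimum_join_synthesis_iff:
  "minimum_join Gh Th M \<longleftrightarrow>
     (\<exists>F Fv. minimum_join G T F \<and> compatible F Fv \<and> M = F \<union> (\<Union>v\<in>B. Fv v))"
proof
  assume M: "minimum_join Gh Th M"
  show "\<exists>F Fv. minimum_join G T F \<and> compatible F Fv \<and> M = F \<union> (\<Union>v\<in>B. Fv v)"
    by (rule exI[of _ "M \<inter> edges G"], rule exI[of _ "\<lambda>v. M \<inter> edges (H v)"])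
      (intro conjI minimum_join_restricts[OF M])
qed (use compatible_minimum in blast)

lemma minimum_join_extends:
  assumes "minimum_join G T F"
  shows "\<exists>M. minimum_join Gh Th M \<and> F \<subseteq> M"
proof -
  obtain Fv where "compatible F Fv" using compatible_exists[OF assms] by auto
  then show ?thesis using compatible_minimum[OF assms] by blast
qed

end

theorem theorem7p10:
  fixes G Gh :: "('v, 'e) mgraph" and T Th A B :: "'v set"
    and H :: "'v \<Rightarrow> ('v, 'e) mgraph" and S AH BH :: "'v \<Rightarrow> 'v set" and r :: "'v \<Rightarrow> 'v"
  assumes "comb G T A B"
    and "\<And>v. v \<in> B \<Longrightarrow> is_graft (H v) (S v) \<and> bipartition (H v) (AH v) (BH v) \<and>
           r v \<in> AH v \<and> primal (H v) (S v) (r v)"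
    and "disjoint_family_on (\<lambda>v. verts (H v)) B"
    and "\<And>v. v \<in> B \<Longrightarrow> verts (H v) \<inter> verts G = {}"
    and "synthesis Gh Th G T A B H S r"
  shows "(\<forall>M. minimum_join Gh Th M \<longleftrightarrow>
            (\<exists>F Fv. minimum_join G T F \<and>
               (\<forall>v\<in>B. \<exists>e r'. edge_cut G {v} \<inter> F = {e} \<and> ends Gh e \<inter> verts (H v) = {r'} \<and>
                  minimum_join (H v) (sym_diff (sym_diff (S v) {r v}) {r'}) (Fv v)) \<and>
               M = F \<union> (\<Union>v\<in>B. Fv v))) \<and>
         (\<forall>F. minimum_join G T F \<longrightarrow> (\<exists>M. minimum_join Gh Th M \<and> F \<subseteq> M))"
proof -
  interpret synthesis_setup G Gh T Th A B H S AH BH r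
    using assms by unfold_locales auto
  show ?thesis
    using minimum_join_synthesis_iff minimum_join_extends by blast
qed

end
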